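(* For every positive integer $n$, the map $\Phi$ defined below is a bijection $\Phi:\mathcal O(n)\to\mathcal D(n)$ which extends Bressoud's map $B$ (i.e. $\Phi(\lambda)=B(\lambda)$ for $\lambda\in\mathcal O(n)\cap\mathcal D(n)$), and for every $\lambda\in\mathcal O(n)$, $$|\Phi(\lambda)|_a=\ell(\lambda)\qquad\text{and}\qquad \ell_o(\Phi(\lambda))=n_o(\lambda).$$
   Context: A partition $\lambda$ of $n$ is a non-increasing sequence $\lambda=(\lambda_1,\dots,\lambda_\ell)$ of positive integers with sum $n$; $\ell(\lambda)=\ell$ is its length, and by convention $\lambda_j=0$ for $j>\ell$. $\mathcal O(n)$ is the set of partitions of $n$ all of whose parts are odd; $\mathcal D(n)$ is the set of partitions of $n$ with distinct parts. The alternating sum is $|\lambda|_a=\sum_{j=1}^{\ell}(-1)^{j-1}\lambda_j$; $\ell_o(\lambda)$ is the number of odd parts of $\lambda$; $m_i(\lambda)$ is the multiplicity of $i$ as a part of $\lambda$; $n_o(\lambda)$ is the number of $i>0$ with $m_i(\lambda)$ odd. For partitions $\alpha,\beta$, $\alpha\circ\beta$ is the partition whose parts are all parts of $\alpha$ and of $\beta$ (with multiplicity) in non-increasing order, and $\alpha^2=\alpha\circ\alpha$. Bressoud's map $B$ on $\mathcal O(n)\cap\mathcal D(n)$: let $\beta\in\mathcal O(n)\cap\mathcal D(n)$. Decompose the parts of $\beta$ into its runs (maximal sequences of consecutive odd integers all occurring as parts of $\beta$). For a run $2m-1>2m-3>\dots>2m-2k+1$, form pairs $(2m-1,2m-3),(2m-5,2m-7),\dots$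 starting from the largest term; if $k$ is odd, the remaining smallest term $c=2m-2k+1$ is replaced by the pair $(\frac{c+1}{2},\frac{c-1}{2})$. Let $\pi=(\pi_1,\dots,\pi_{2s})$ be the concatenation of all these pairs, runs in decreasing order and pairs within a run in the order formed; the pairs of $\pi$ are $(\pi_{2j-1},\pi_{2j})$. A pair interchange: if $(\pi_{2j-1},\pi_{2j})=(a+1,a)$ and $(\pi_{2j+1},\pi_{2j+2})=(2b+1,2b-1)$ with $a\le 2b+1$, replace these four entries by $(2b+3,2b+1,a-1,a-2)$. Starting from $\pi$, repeatedly perform pair interchanges (each time the leftmost available one) until none is possible, then delete zero entries; the result is $B(\beta)$ (for $\beta$ empty, $B(\beta)$ is empty). Insertion: for a partition $\gamma$ (with $\gamma_k=0$ for $k>\ell(\gamma)$) and an integer $a\ge1$, define $I_a(\gamma)$ (the insertion of the pair $(2a-1)^2$) as follows. For $j=0,1,2,\dots$ in turn: if $j=a-1$, set $I_a(\gamma)=(\gamma_1+2,\dots,\gamma_{2j}+2,\gamma_{2j+1}+2,\gamma_{2j+2},\gamma_{2j+3},\dots)$ and stop; otherwise, if $2a-2j-2>\gamma_{2j+1}$, set $I_a(\gamma)=(\gamma_1+2,\dots,\gamma_{2j}+2,\,2a-2j,\,2a-2j-2,\,\gamma_{2j+1},\gamma_{2j+2},\dots)$ and stop; otherwise pass to $j+1$. Zero entries are discarded. The map $\Phi$: for $\lambda\in\mathcal O(n)$ write uniquely $\lambda=\alpha^2\circ\beta$ with $\beta$ having distinct parts (so $\beta$ consists of the parts $i$ with $m_i(\lambda)$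 odd, each once, and $\alpha$ contains each $i$ with multiplicity $\lfloor m_i(\lambda)/2\rfloor$). Let $t=\ell(\alpha)$ and $\alpha_i=2a_i-1$ for $i=1,\dots,t$ (with $\alpha_1\ge\dots\ge\alpha_t$). Set $\gamma^{(0)}=B(\beta)$ and $\gamma^{(i)}=I_{a_i}(\gamma^{(i-1)})$ for $i=1,\dots,t$, and define $\Phi(\lambda)=\gamma^{(t)}$. *)

theory Defs
  imports Main "HOL-Library.While_Combinator"
begin

definition is_partition :: "nat \<Rightarrow> nat list \<Rightarrow> bool" where
  "is_partition n xs \<longleftrightarrow> sorted_wrt (\<ge>) xs \<and> (\<forall>x\<in>set xs. 0 < x) \<and> sum_list xs = n"

definition odd_parts :: "nat \<Rightarrow> nat list set" where
  "odd_parts n = {xs. is_partition n xs \<and> (\<forall>x\<in>set xs. odd x)}"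

definition distinct_parts :: "nat \<Rightarrow> nat list set" where
  "distinct_parts n = {xs. is_partition n xs \<and> distinct xs}"

definition alt_sum :: "nat list \<Rightarrow> int" where
  "alt_sum xs = (\<Sum>j<length xs. (-1) ^ j * int (xs ! j))"

definition num_odd_parts :: "nat list \<Rightarrow> nat" where
  "num_odd_parts xs = length (filter odd xs)"

definition n_odd_mult :: "nat list \<Rightarrow> nat" where
  "n_odd_mult xs = card {i. 0 < i \<and> odd (count_list xs i)}"

fun runs :: "nat list \<Rightarrow> nat list list" where
  "runs [] = []"
| "runs [x] = [[x]]"
| "runs (x # y # r) =
     (if x = y + 2 then (case runs (y # r) of [] \<Rightarrow> [[x]] | g # gs \<Rightarrow> (x # g) # gs)
      else [x] # runs (y # r))"

fun pair_run :: "nat list \<Rightarrow> (nat \<times> nat) list" where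
  "pair_run [] = []"
| "pair_run [c] = [((c + 1) div 2, (c - 1) div 2)]"
| "pair_run (x # y # r) = (x, y) # pair_run r"

definition initial_pairs :: "nat list \<Rightarrow> (nat \<times> nat) list" where
  "initial_pairs \<beta> = concat (map pair_run (runs \<beta>))"

fun interchange_step :: "(nat \<times> nat) list \<Rightarrow> (nat \<times> nat) list option" where
  "interchange_step ((x1, y1) # (x2, y2) # rest) =
     (if x1 = y1 + 1 \<and> odd y2 \<and> x2 = y2 + 2 \<and> y1 \<le> x2
      then Some ((x2 + 2, x2) # (y1 - 1, y1 - 2) # rest)
      else map_option ((#) (x1, y1)) (interchange_step ((x2, y2) # rest)))"
| "interchange_step _ = None"

definition interchange_all :: "(nat \<times> nat) list \<Rightarrow> (nat \<times> nat) list" where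
  "interchange_all \<pi> =
     the (while_option (\<lambda>p. interchange_step p \<noteq> None) (\<lambda>p. the (interchange_step p)) \<pi>)"

definition bressoud :: "nat list \<Rightarrow> nat list" where
  "bressoud \<beta> =
     filter (\<lambda>x. x \<noteq> 0) (concat (map (\<lambda>(x, y). [x, y]) (interchange_all (initial_pairs \<beta>))))"

definition pad :: "nat list \<Rightarrow> nat \<Rightarrow> nat list" where
  "pad g m = g @ replicate (m - length g) 0"

function ins_from :: "nat \<Rightarrow> nat \<Rightarrow> nat list \<Rightarrow> nat list" where
  "ins_from a j g =
     (if a - 1 \<le> j then map (\<lambda>x. x + 2) (take (2 * j + 1) g) @ drop (2 * j + 1) g
      else if g ! (2 * j) < 2 * a - 2 * j - 2
      then map (\<lambda>x. x + 2) (take (2 * j) g) @ [2 * a - 2 * j, 2 * a - 2 * j - 2] @ drop (2 * j) g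
      else ins_from a (j + 1) g)"
  by pat_completeness auto
termination by (relation "measure (\<lambda>(a, j, g). a - j)") auto

text \<open>I_a(gamma): gamma padded with zeros (gamma_k = 0 for k > length), zeros discarded.\<close>
definition insert_pair :: "nat \<Rightarrow> nat list \<Rightarrow> nat list" where
  "insert_pair a g = filter (\<lambda>x. x \<noteq> 0) (ins_from a 0 (pad g (2 * a)))"

definition beta_part :: "nat list \<Rightarrow> nat list" where
  "beta_part lam = rev (sorted_list_of_set {i \<in> set lam. odd (count_list lam i)})"

definition alpha_part :: "nat list \<Rightarrow> nat list" where
  "alpha_part lam =
     concat (map (\<lambda>i. replicate (count_list lam i div 2) i) (rev (sorted_list_of_set (set lam))))"

definition Phi :: "nat list \<Rightarrow> nat list" where
  "Phi lam = foldl (\<lambda>g x. insert_pair ((x + 1) div 2) g) (bressoud (beta_part lam)) (alpha_part lam)"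

end

(* Group the parts of a strict partition into consecutive pairs (l1, l2), (l3, l4), ..., adding a
   final 0 if needed.  Inserting (2a-1)^2 either creates an even pair of difference 2 or widens a
   difference to at least 3 (or to (2, 0)); conversely each such pair can be removed and determines
   the value of a.  Inserting in weakly decreasing order of a means that the last insertion is undone
   by the removal with the smallest a, and what remains when nothing can be removed is exactly a
   sequence of pairs (a+1, a) and (2b+1, 2b-1), the shape of the images of Bressoud's map.

   Call these two kinds of pairs singles and doubles.  An interchange moves a single past a double,
   decreasing a by 2 and increasing b by 1.  Hence "a minus twice the number of doubles to its right"
   and "b minus the number of singles to its right" are invariants.  The two sequences of invariants
   (each with gaps at least 2) leave only the choice of the interleaving, and exactly one interleaving
   comes from a distinct odd partition and exactly one is stable under interchanges. *)
theory Submission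
  imports Defs "HOL-Library.Multiset"
begin

section \<open>Strict partitions as lists of pairs\<close>

text \<open>A list of pairs with decreasing entries encodes a strict partition; its very last entry may be 0.\<close>
definition unpair :: "(nat \<times> nat) list \<Rightarrow> nat list" where
  "unpair p = filter (\<lambda>x. x \<noteq> 0) (concat (map (\<lambda>(x, y). [x, y]) p))"

fun decr :: "(nat \<times> nat) list \<Rightarrow> bool" where
  "decr [] \<longleftrightarrow> True"
| "decr ((x, y) # p) \<longleftrightarrow> y < x \<and> (p \<noteq> [] \<longrightarrow> fst (hd p) < y) \<and> decr p"

fun pairs_of :: "nat list \<Rightarrow> (nat \<times> nat) list" where
  "pairs_of [] = []"
| "pairs_of [x] = [(x, 0)]"
| "pairs_of (x # y # r) = (x, y) # pairs_of r"

definition pair_sum :: "(nat \<times> nat) list \<Rightarrow> nat" where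
  "pair_sum p = (\<Sum>(x, y)\<leftarrow>p. x + y)"

definition pair_alt :: "(nat \<times> nat) list \<Rightarrow> int" where
  "pair_alt p = (\<Sum>(x, y)\<leftarrow>p. int x - int y)"

definition pair_odd :: "(nat \<times> nat) list \<Rightarrow> nat" where
  "pair_odd p = (\<Sum>(x, y)\<leftarrow>p. (if odd x then 1 else 0) + (if odd y then 1 else 0))"

lemma unpair_simps [simp]:
  "unpair [] = []"
  "unpair ((x, y) # p) = (if x \<noteq> 0 then [x] else []) @ (if y \<noteq> 0 then [y] else []) @ unpair p"
  by (auto simp: unpair_def)

lemma pair_stat_simps [simp]:
  "pair_sum [] = 0" "pair_sum ((x, y) # p) = x + y + pair_sum p"
  "pair_alt [] = 0" "pair_alt ((x, y) # p) = int x - int y + pair_alt p"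
  "pair_odd [] = 0"
  "pair_odd ((x, y) # p) = (if odd x then 1 else 0) + (if odd y then 1 else 0) + pair_odd p"
  by (auto simp: pair_sum_def pair_alt_def pair_odd_def)

lemma sum_list_unpair: "sum_list (unpair p) = pair_sum p"
  by (induction p) auto

lemma num_odd_parts_unpair: "num_odd_parts (unpair p) = pair_odd p"
  unfolding num_odd_parts_def by (induction p) auto

lemma alt_sum_Nil [simp]: "alt_sum [] = 0"
  by (simp add: alt_sum_def)

lemma alt_sum_Cons [simp]: "alt_sum (x # xs) = int x - alt_sum xs"
  unfolding alt_sum_def length_Cons sum.lessThan_Suc_shift
  by (simp add: sum_negf)

text \<open>Deleting a zero in the middle would flip all later signs. Under \<open>decr\<close> a
  pair with \<open>y = 0\<close> has no successor, so only a final zero is ever dropped.\<close>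

lemma alt_sum_unpair: "decr p \<Longrightarrow> alt_sum (unpair p) = pair_alt p"
proof (induction p)
  case (Cons z p)
  then show ?case by (cases z; cases "snd z = 0") auto
qed simp

lemma pairs_of_unpair: "decr p \<Longrightarrow> pairs_of (unpair p) = p"
proof (induction p)
  case (Cons z p)
  then show ?case by (cases z; cases "snd z = 0") auto
qed simp

lemma inj_on_unpair: "inj_on unpair {p. decr p}"
  by (metis inj_onI mem_Collect_eq pairs_of_unpair)

text \<open>The bound by the first entry strengthens the induction: it extends the comparison of
  neighbouring pairs to all later entries.\<close>

lemma decr_sorted: "decr p \<Longrightarrow> sorted_wrt (>) (unpair p) \<and> (p \<noteq> [] \<longrightarrow> (\<forall>z\<in>set (unpair p). z \<le> fst (hd p)))"
proof (induction p)
  case (Cons z p)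
  obtain x y where z: "z = (x, y)" by (cases z)
  have IH: "sorted_wrt (>) (unpair p)" "\<forall>z\<in>set (unpair p). p \<noteq> [] \<longrightarrow> z \<le> fst (hd p)"
    using Cons by (auto simp: z)
  show ?case
  proof (cases "p = []")
    case False
    then have "\<forall>z\<in>set (unpair p). z < y"
      using IH Cons.prems by (fastforce simp: z)
    then show ?thesis using IH(1) Cons.prems by (fastforce simp: z)
  qed (use Cons.prems in \<open>auto simp: z\<close>)
qed simp

lemma decr_pairs_of:
  "sorted_wrt (>) xs \<Longrightarrow> 0 \<notin> set xs \<Longrightarrow> decr (pairs_of xs) \<and> unpair (pairs_of xs) = xs"
proof (induction xs rule: pairs_of.induct)
  case (3 x y r)
  then show ?case by (cases r rule: pairs_of.cases) auto
qed auto

lemma distinct_parts_eq: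
  "distinct_parts n = {xs. sorted_wrt (>) xs \<and> 0 \<notin> set xs \<and> sum_list xs = n}"
proof -
  have "sorted_wrt (>) xs \<longleftrightarrow> sorted_wrt (\<ge>) xs \<and> distinct xs" for xs :: "nat list"
    by (induction xs) (auto simp: order_less_le)
  moreover have "0 \<notin> set xs \<longleftrightarrow> (\<forall>x\<in>set xs. 0 < x)" for xs :: "nat list"
    by (metis gr_zeroI less_irrefl)
  ultimately show ?thesis unfolding distinct_parts_def is_partition_def by blast
qed

lemma bij_betw_unpair:
  "bij_betw unpair {p. decr p \<and> pair_sum p = n} (distinct_parts n)"
proof (rule bij_betw_imageI)
  show "inj_on unpair {p. decr p \<and> pair_sum p = n}"
    by (rule inj_on_subset[OF inj_on_unpair]) auto
  show "unpair ` {p. decr p \<and> pair_sum p = n} = distinct_parts n"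
  proof
    show "unpair ` {p. decr p \<and> pair_sum p = n} \<subseteq> distinct_parts n"
      by (auto simp: distinct_parts_eq sum_list_unpair decr_sorted) (auto simp: unpair_def)
    show "distinct_parts n \<subseteq> unpair ` {p. decr p \<and> pair_sum p = n}"
    proof
      fix xs assume "xs \<in> distinct_parts n"
      then have "decr (pairs_of xs)" "unpair (pairs_of xs) = xs" "sum_list xs = n"
        using decr_pairs_of[of xs] by (auto simp: distinct_parts_eq)
      then show "xs \<in> unpair ` {p. decr p \<and> pair_sum p = n}"
        by (metis (mono_tags, lifting) imageI mem_Collect_eq sum_list_unpair)
    qed
  qed
qed

section \<open>Inserting and removing pairs\<close>

text \<open>For \<open>a = 1\<close> the first equation yields \<open>(2, 0)\<close>, which agrees with adding 2 to the first
  entry of an empty pair. Passing to the next pair replaces \<open>2a - 2j - 2\<close> by its value for \<open>a - 1\<close>.\<close>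
fun pair_insert :: "nat \<Rightarrow> (nat \<times> nat) list \<Rightarrow> (nat \<times> nat) list" where
  "pair_insert a [] = [(2 * a, 2 * a - 2)]"
| "pair_insert a ((x, y) # p) =
     (if a \<le> 1 then (x + 2, y) # p
      else if x < 2 * a - 2 then (2 * a, 2 * a - 2) # (x, y) # p
      else (x + 2, y + 2) # pair_insert (a - 1) p)"

text \<open>The \<open>j\<close>-th pair (from 0) is removable if its difference is at least 3, which undoes an insertion
  for \<open>j + 1\<close>, or if it is even with difference 2, which undoes one for \<open>j + x / 2\<close>.
  The predicate says that all these values are at least \<open>a\<close>.\<close>
fun removal_bound :: "nat \<Rightarrow> (nat \<times> nat) list \<Rightarrow> bool" where
  "removal_bound a [] \<longleftrightarrow> True"
| "removal_bound a ((x, y) # p) \<longleftrightarrow>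
     a \<le> 1 \<or> x \<le> y + 2 \<and> (even x \<and> x = y + 2 \<longrightarrow> 2 * a \<le> x) \<and> removal_bound (a - 1) p"

text \<open>Under \<open>decr\<close>, excluding differences above 2 and even pairs of difference 2
  leaves exactly these two shapes, so no pair is removable.\<close>

definition reduced :: "(nat \<times> nat) list \<Rightarrow> bool" where
  "reduced p \<longleftrightarrow> (\<forall>(x, y)\<in>set p. x = y + 1 \<or> x = y + 2 \<and> odd x)"

lemma reduced_simps [simp]:
  "reduced []"
  "reduced ((x, y) # p) \<longleftrightarrow> (x = y + 1 \<or> x = y + 2 \<and> odd x) \<and> reduced p"
  by (auto simp: reduced_def)

lemma reduced_removal_bound: "reduced p \<Longrightarrow> removal_bound a p"
  by (induction a p rule: removal_bound.induct) auto

lemma pair_insert_neq_Nil [simp]: "pair_insert a p \<noteq> []" "[] \<noteq> pair_insert a p"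
  by (cases "(a, p)" rule: pair_insert.cases; auto)+

text \<open>Each pair passed gains 4 while \<open>4 * a - 2\<close> drops by 4, and the stopping
  step adds \<open>4 * a - 2\<close> for the current \<open>a\<close>. For the next two lemmas: only
  the stopping step affects the differences, adding 2, and all changes preserve the number of odd
  entries.\<close>

lemma pair_sum_pair_insert: "1 \<le> a \<Longrightarrow> pair_sum (pair_insert a p) = pair_sum p + (4 * a - 2)"
  by (induction a p rule: pair_insert.induct) auto

lemma pair_alt_pair_insert: "1 \<le> a \<Longrightarrow> pair_alt (pair_insert a p) = pair_alt p + 2"
  by (induction a p rule: pair_insert.induct) auto

lemma pair_odd_pair_insert: "1 \<le> a \<Longrightarrow> pair_odd (pair_insert a p) = pair_odd p"
  by (induction a p rule: pair_insert.induct) auto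

lemma pair_insert_hd_bound:
  "1 \<le> a \<Longrightarrow> decr p \<Longrightarrow> fst (hd (pair_insert a p)) = 2 * a \<or> (p \<noteq> [] \<and> fst (hd (pair_insert a p)) = fst (hd p) + 2)"
  by (cases "(a, p)" rule: pair_insert.cases) auto

lemma pair_insert_hd_ge:
  "1 \<le> a \<Longrightarrow> decr p \<Longrightarrow> 2 * a \<le> fst (hd (pair_insert a p))"
  by (cases "(a, p)" rule: pair_insert.cases) auto

text \<open>The only danger is that a pair created in the tail does not fit below
  \<open>y + 2\<close>; this would need a removable front pair of value less than
  \<open>a\<close>.\<close>

lemma decr_pair_insert:
  "1 \<le> a \<Longrightarrow> decr p \<Longrightarrow> removal_bound a p \<Longrightarrow> decr (pair_insert a p)"
proof (induction a p rule: pair_insert.induct)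
  case (2 a x y p)
  show ?case
  proof (cases "a \<le> 1 \<or> x < 2 * a - 2")
    case True
    then show ?thesis using 2 by auto
  next
    case False
    then have a1: "1 \<le> a - 1" by (simp add: not_le Suc_le_eq)
    with False have "decr (pair_insert (a - 1) p)" using 2 by auto
    moreover have "fst (hd (pair_insert (a - 1) p)) < y + 2"
    proof -
      \<comment> \<open>Otherwise \<open>y + 2 \<le> 2 * a - 2 \<le> x \<le> y + 2\<close>, which
        leaves only the even pair with \<open>x = 2 * a - 2\<close>, of value
        \<open>a - 1\<close>.\<close>
      have "2 * (a - 1) < y + 2"
      proof (rule ccontr)
        assume "\<not> ?thesis"
        then have x: "x = y + 2" "x = 2 * (a - 1)" using False 2 by auto
        have "even x" unfolding x(2) by simp
        then have "2 * a \<le> x" using 2(4) x(1) False by simp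
        then show False using x(2) 2(2) by simp
      qed
      then show ?thesis using pair_insert_hd_bound[OF a1, of p] 2(3,4) by auto
    qed
    ultimately show ?thesis using 2 False by auto
  qed
qed auto

text \<open>First entries drop by at least 2 from pair to pair, as fast as \<open>2 * a\<close>
  does, so the assumption on the head passes down the list. An even pair of difference 2 would then
  violate the bound everywhere, so nothing is removable at all.\<close>

lemma removal_bound_of_small: "removal_bound a p \<Longrightarrow> decr p \<Longrightarrow> p = [] \<or> fst (hd p) + 2 < 2 * a \<Longrightarrow> removal_bound b p"
proof (induction a p arbitrary: b rule: removal_bound.induct)
  case (2 a x y p)
  have "\<not> a \<le> 1" using 2 by simp
  moreover have "p = [] \<or> fst (hd p) + 2 < 2 * (a - 1)"
    using 2 by auto
  ultimately have "removal_bound (b - 1) p" using 2 by auto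
  then show ?case using 2 by auto
qed auto

text \<open>This identifies the inserted value as the smallest removable one. A widened front pair
  allows only \<open>b \<le> 1\<close>; a new front pair has value \<open>a\<close>, and
  \<open>removal_bound_of_small\<close> leaves nothing removable behind it; passing a pair lowers
  both \<open>a\<close> and \<open>b\<close> by 1.\<close>

lemma removal_bound_pair_insert_iff:
  "1 \<le> a \<Longrightarrow> decr p \<Longrightarrow> removal_bound a p \<Longrightarrow> removal_bound b (pair_insert a p) \<longleftrightarrow> b \<le> a"
proof (induction a p arbitrary: b rule: pair_insert.induct)
  case (1 a)
  then show ?case by auto
next
  case (2 a x y p)
  show ?case
  proof (cases "a \<le> 1 \<or> x < 2 * a - 2")
    case True
    then show ?thesis
    proof
      assume "a \<le> 1"
      then show ?thesis using 2 by auto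
    next
      assume x: "x < 2 * a - 2"
      have *: "removal_bound c ((x, y) # p)" for c
        by (rule removal_bound_of_small[of a]) (use 2 x in auto)
      show ?thesis using x *[of "b - 1"] 2 by (auto simp del: removal_bound.simps(2) simp: removal_bound.simps(2)[of b])
    qed
  next
    case False
    then have IH: "removal_bound (b - 1) (pair_insert (a - 1) p) \<longleftrightarrow> b - 1 \<le> a - 1" using 2 by auto
    show ?thesis using False 2 by (auto simp: IH)
  qed
qed

text \<open>For \<open>a > 1\<close>, a result beginning with \<open>(2 * a, 2 * a - 2)\<close>
  could stem from a new pair or from raising \<open>(2 * a - 2, 2 * a - 4)\<close>. The latter is
  removable with value \<open>a - 1\<close>, which the bound excludes.\<close>

lemma pair_insert_inj:
  "1 \<le> a \<Longrightarrow> decr p \<Longrightarrow> removal_bound a p \<Longrightarrow> decr q \<Longrightarrow> removal_bound a q \<Longrightarrow> pair_insert a p = pair_insert a q \<Longrightarrow> p = q"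
proof (induction a p arbitrary: q rule: pair_insert.induct)
  case (1 a)
  then show ?case by (cases q) (auto split: if_splits)
next
  case (2 a x y p)
  then show ?case
  proof (cases q)
    case Nil
    then show ?thesis using 2 by (auto split: if_splits)
  next
    case (Cons z q')
    obtain x' y' where z: "z = (x', y')" by (cases z)
    have *: "\<not> (u = 2 * a - 2 \<and> v = 2 * a - 4)" if "\<not> a \<le> 1" "removal_bound a ((u, v) # r)" for u v r
      using that by auto
    show ?thesis
    proof (cases "a \<le> 1")
      case True
      then show ?thesis using 2(7) by (auto simp: z Cons)
    next
      case False
      have "\<not> (x = 2 * a - 2 \<and> y = 2 * a - 4)" "\<not> (x' = 2 * a - 2 \<and> y' = 2 * a - 4)"
        using *[of x y p] *[of x' y' q'] False 2 by (auto simp: z Cons)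
      moreover have "p = q'" if "\<not> x < 2 * a - 2" "\<not> x' < 2 * a - 2"
        using 2 that False by (auto simp: z Cons)
      ultimately show ?thesis using False 2(7) by (auto simp: z Cons split: if_splits)
    qed
  qed
qed

text \<open>The pair removed must have the least value. A front difference of at least 3 has value
  1, and a removable pair in the tail has a smaller value than an even front pair of difference 2,
  so the tail is searched before such a front pair is removed.\<close>

lemma pair_insert_surj:
  "decr p \<Longrightarrow> \<not> reduced p \<Longrightarrow> \<exists>a q. 1 \<le> a \<and> decr q \<and> removal_bound a q \<and> pair_insert a q = p"
proof (induction p)
  case (Cons z p)
  obtain x y where z: "z = (x, y)" by (cases z)
  have "y < x" "\<not> reduced ((x, y) # p)" "y = 0 \<Longrightarrow> p = []"
    using Cons.prems by (auto simp: z)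
  then consider "y + 3 \<le> x" | "x = 2" "y = 0" "p = []" | "x \<le> y + 2" "\<not> reduced p"
    | "reduced p" "x = y + 2" "even x" "y \<noteq> 0"
  proof (cases "y + 3 \<le> x \<or> \<not> reduced p")
    case True
    then show ?thesis using that(1,3) by linarith
  next
    case False
    then have "x \<le> y + 2" "x \<noteq> y + 1 \<and> (x \<noteq> y + 2 \<or> even x)" using \<open>\<not> reduced ((x, y) # p)\<close> by simp_all
    then have "x = y + 2" "even x" using \<open>y < x\<close> by linarith+
    then show ?thesis using that(2,4) False \<open>y = 0 \<Longrightarrow> p = []\<close> by (cases "y = 0") auto
  qed
  then show ?case
  proof cases
    case 1
    then show ?thesis using Cons.prems
      by (intro exI[of _ 1] exI[of _ "(x - 2, y) # p"]) (auto simp: z)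
  next
    \<comment> \<open>Lowering \<open>(2, 0)\<close> would give the forbidden pair
      \<open>(0, 0)\<close>, so the pair disappears.\<close>
    case 2
    then show ?thesis using Cons.prems
      by (intro exI[of _ 1] exI[of _ "[]"]) (auto simp: z)
  next
    case 3
    then obtain a q where a: "1 \<le> a" "decr q" "removal_bound a q" "pair_insert a q = p"
      using Cons by (auto simp: z)
    have y: "2 * a < y" "fst (hd p) < y"
      using pair_insert_hd_ge[of a q] a Cons.prems by (fastforce simp: z)+
    obtain u v where uv: "x = u + 2" "y = v + 2"
      using that[of "x - 2" "y - 2"] a(1) y(1) \<open>y < x\<close> by simp
    have "q \<noteq> [] \<Longrightarrow> fst (hd q) < v"
      using a y by (cases "(a, q)" rule: pair_insert.cases) (auto simp: uv split: if_splits)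
    \<comment> \<open>Here \<open>2 * a < y = u\<close> with both sides even, so they differ by at
      least 2.\<close>
    moreover have "even u \<Longrightarrow> u = v + 2 \<Longrightarrow> 2 * (a + 1) \<le> u"
      using y(1) uv by presburger
    ultimately have "decr ((u, v) # q)" "removal_bound (a + 1) ((u, v) # q)"
      using a y 3(1) \<open>y < x\<close> by (auto simp: uv)
    moreover have "pair_insert (a + 1) ((u, v) # q) = z # p"
      using a y \<open>y < x\<close> by (simp add: z uv)
    ultimately show ?thesis by (metis le_add2)
  next
    case 4
    from 4(3) obtain k where "x = 2 * k" by (elim evenE)
    then have k: "x = 2 * k" "y = 2 * (k - 1)" "2 \<le> k" using 4(2,4) by simp_all
    have "pair_insert k p = (x, y) # p"
      using k Cons.prems by (cases "(k, p)" rule: pair_insert.cases) (auto simp: z)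
    then show ?thesis using k 4 Cons.prems
      by (intro exI[of _ k] exI[of _ p]) (auto simp: z reduced_removal_bound)
  qed
qed (simp add: reduced_def)

section \<open>Agreement of insertion on lists with insertion on pairs\<close>

declare ins_from.simps [simp del]

text \<open>The recursion inspects and raises at most the first \<open>2 * a - 1\<close> entries, so
  extra zeros stay at the end until they are filtered out. The exact amount of padding is thus
  irrelevant.\<close>

lemma ins_from_zeros:
  assumes "2 * a - 1 \<le> length g" "j < a" "\<forall>x\<in>set zs. x = 0"
  shows "filter (\<lambda>x. x \<noteq> 0) (ins_from a j (g @ zs)) = filter (\<lambda>x. x \<noteq> 0) (ins_from a j g)"
  using assms
proof (induction a j g rule: ins_from.induct)
  case (1 a j g)
  have zs: "filter (\<lambda>x. x \<noteq> 0) zs = []" using 1 by (simp add: filter_empty_conv)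
  have len: "2 * j + 1 \<le> length g" "2 * j < length g" using 1 by auto
  show ?case
  proof (cases "a - 1 \<le> j \<or> g ! (2 * j) < 2 * a - 2 * j - 2")
    case True
    then show ?thesis using len zs by (subst (1 2) ins_from.simps) (auto simp: nth_append)
  next
    case False
    then have "filter (\<lambda>x. x \<noteq> 0) (ins_from a (j + 1) (g @ zs)) = filter (\<lambda>x. x \<noteq> 0) (ins_from a (j + 1) g)"
      using 1 by auto
    then show ?thesis using False len by (subst (1 2) ins_from.simps) (auto simp: nth_append)
  qed
qed

abbreviation "flat p \<equiv> concat (map (\<lambda>(x, y). [x, y]) p)"

text \<open>\<open>pre\<close> holds the \<open>2 * j\<close> entries already passed:
  \<open>ins_from\<close> raises them only when it stops, while \<open>pair_insert\<close> raises
  each pair on the way.\<close>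

lemma filter_ins_from_flat:
  assumes "length pre = 2 * j" "j < a" "2 * (a - j) \<le> m"
  shows "filter (\<lambda>x. x \<noteq> 0) (ins_from a j (pre @ flat p @ replicate m 0))
    = map (\<lambda>x. x + 2) pre @ unpair (pair_insert (a - j) p)"
  using assms
proof (induction "a - j" arbitrary: j pre p)
  case (Suc d)
  have a: "a = Suc (d + j)" using Suc by simp
  obtain n where m: "m = Suc (Suc n)"
    using that[of "m - 2"] Suc(2,5) by simp
  note unfold = ins_from.simps[of a j]
  show ?case
  proof (cases p)
    \<comment> \<open>Only zeros remain. For \<open>d = 0\<close> the first of them becomes 2,
      otherwise \<open>0 < 2 * d\<close> triggers the creation of a pair.\<close>
    case Nil
    have take: "take (2 * j + 1) (pre @ replicate m 0) = pre @ [0]" "drop (2 * j + 1) (pre @ replicate m 0) = replicate (Suc n) 0"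
      "take (2 * j) (pre @ replicate m 0) = pre" "drop (2 * j) (pre @ replicate m 0) = replicate m 0"
      "(pre @ replicate m 0) ! (2 * j) = 0"
      using Suc.prems(1) by (simp_all add: m nth_append)
    have "ins_from a j (pre @ replicate m 0) = (if d = 0 then map (\<lambda>x. x + 2) (pre @ [0]) @ replicate (Suc n) 0
        else map (\<lambda>x. x + 2) pre @ [2 * d + 2, 2 * d] @ replicate m 0)"
      by (subst unfold) (simp only: take, simp add: a)
    then show ?thesis
      by (simp add: Nil a filter_map o_def)
  next
    case (Cons z q)
    obtain x y where z: "z = (x, y)" by (cases z)
    let ?g = "pre @ flat p @ replicate m 0"
    have take: "take (2 * j + 1) ?g = pre @ [x]" "drop (2 * j + 1) ?g = y # flat q @ replicate m 0"
      "take (2 * j) ?g = pre" "drop (2 * j) ?g = flat p @ replicate m 0"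
      "?g ! (2 * j) = x"
      using Suc.prems(1) by (simp_all add: Cons z nth_append)
    show ?thesis
    proof (cases "d = 0 \<or> x < 2 * d")
      case True
      have "ins_from a j ?g = (if d = 0 then map (\<lambda>x. x + 2) (pre @ [x]) @ y # flat q @ replicate m 0
          else map (\<lambda>x. x + 2) pre @ [2 * d + 2, 2 * d] @ flat p @ replicate m 0)"
        using True by (subst unfold) (simp only: take, auto simp: a)
      then show ?thesis using True
        by (auto simp add: Cons z a filter_map o_def unpair_def)
    next
      case False
      have "ins_from a j ?g = ins_from a (j + 1) ((pre @ [x, y]) @ flat q @ replicate m 0)"
        using False by (subst unfold) (simp only: take, simp add: a Cons z)
      moreover have "filter (\<lambda>x. x \<noteq> 0) (ins_from a (j + 1) ((pre @ [x, y]) @ flat q @ replicate m 0)) =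
         map (\<lambda>x. x + 2) (pre @ [x, y]) @ unpair (pair_insert (a - (j + 1)) q)"
        by (rule Suc(1)) (use Suc.prems False in \<open>auto simp: a\<close>)
      ultimately show ?thesis using False by (simp add: Cons z a)
    qed
  qed
qed simp

lemma insert_pair_unpair:
  assumes "decr p" "1 \<le> a"
  shows "insert_pair a (unpair p) = unpair (pair_insert a p)"
proof -
  have "\<exists>m. flat p = unpair p @ replicate m 0"
    using assms(1)
  proof (induction p)
    case (Cons z p)
    obtain x y where z: "z = (x, y)" by (cases z)
    show ?case
    proof (cases "y = 0")
      case True
      then show ?thesis using Cons.prems by (auto simp: z intro!: exI[of _ 1])
    next
      case False
      then show ?thesis using Cons by (auto simp: z)
    qed
  qed simp
  then obtain m where m: "flat p = unpair p @ replicate m 0" by blast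
  let ?g = "pad (unpair p) (2 * a)"
  \<comment> \<open>The flattened pairs and the padded list differ only in trailing zeros, which
    \<open>ins_from_zeros\<close> ignores.\<close>
  have "\<exists>m'. flat p @ replicate (2 * a) 0 = ?g @ replicate m' 0"
    by (simp add: m pad_def flip: replicate_add) (metis add.commute add.left_commute diff_le_self le_add_diff_inverse2)
  then obtain m' where m': "flat p @ replicate (2 * a) 0 = ?g @ replicate m' 0" by blast
  have "insert_pair a (unpair p) = filter (\<lambda>x. x \<noteq> 0) (ins_from a 0 ?g)"
    by (simp add: insert_pair_def)
  also have "\<dots> = filter (\<lambda>x. x \<noteq> 0) (ins_from a 0 (?g @ replicate m' 0))"
    by (rule ins_from_zeros[symmetric]) (use assms in \<open>auto simp: pad_def\<close>)
  also have "\<dots> = unpair (pair_insert a p)"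
    using filter_ins_from_flat[of "[]" 0 a "2 * a" p] assms by (simp flip: m')
  finally show ?thesis .
qed

section \<open>Interleavings of singles and doubles\<close>

datatype block = Single nat | Double nat

text \<open>By truncated subtraction \<open>Double 0\<close> also yields \<open>(1, 0)\<close>, the
  pair of \<open>Single 0\<close>; this is why \<open>valid\<close> excludes it.\<close>

fun pair_of :: "block \<Rightarrow> nat \<times> nat" where
  "pair_of (Single a) = (a + 1, a)"
| "pair_of (Double b) = (2 * b + 1, 2 * b - 1)"

text \<open>For \<open>k = 1\<close> the adjacency conditions describe the pairs built from the runs of a distinct odd
  partition, for \<open>k = 2\<close> they say that the entries strictly decrease and no interchange is possible.\<close>
fun fits :: "nat \<Rightarrow> block \<Rightarrow> block \<Rightarrow> bool" where
  "fits k (Single a) (Single a') \<longleftrightarrow> a' + 2 \<le> a"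
| "fits k (Single a) (Double b) \<longleftrightarrow> k * b + 2 \<le> a"
| "fits k (Double b) (Single a) \<longleftrightarrow> a + k + 1 \<le> k * b"
| "fits k (Double b) (Double b') \<longleftrightarrow> b' + 2 \<le> b"

fun valid :: "nat \<Rightarrow> block list \<Rightarrow> bool" where
  "valid k [] \<longleftrightarrow> True"
| "valid k (i # x) \<longleftrightarrow> i \<noteq> Double 0 \<and> (x \<noteq> [] \<longrightarrow> fits k i (hd x)) \<and> valid k x"

text \<open>\<open>ss\<close> and \<open>bs\<close> are the invariant sequences of singles and doubles, \<open>x\<close> one of their interleavings.\<close>
inductive arranged :: "block list \<Rightarrow> nat list \<Rightarrow> nat list \<Rightarrow> bool" where
  arr_Nil: "arranged [] [] []"
| arr_Single: "arranged x ss bs \<Longrightarrow> arranged (Single (a + 2 * length bs) # x) (a # ss) bs"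
| arr_Double: "arranged x ss bs \<Longrightarrow> arranged (Double (b + length ss) # x) ss (b # bs)"

text \<open>The bound \<open>m\<close> is 0 for singles and 1 for doubles, in line with the
  exclusion of \<open>Double 0\<close>; the gap 2 is what \<open>fits\<close> demands of neighbours
  of the same kind.\<close>

fun spaced :: "nat \<Rightarrow> nat list \<Rightarrow> bool" where
  "spaced m [] \<longleftrightarrow> True"
| "spaced m (a # ss) \<longleftrightarrow> m \<le> a \<and> (ss \<noteq> [] \<longrightarrow> hd ss + 2 \<le> a) \<and> spaced m ss"

lemma spaced_hd: "spaced m ss \<Longrightarrow> ss \<noteq> [] \<Longrightarrow> m + 2 * length ss \<le> hd ss + 2"
proof (induction ss)
  case (Cons a ss)
  then show ?case by (cases ss) auto
qed simp

inductive_cases arr_NilE: "arranged [] ss bs"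
inductive_cases arr_SingleE: "arranged (Single a # x) ss bs"
inductive_cases arr_DoubleE: "arranged (Double b # x) ss bs"

text \<open>A leading block is compared with the first block of the other kind, at the value the
  latter would have if moved to the front of \<open>x\<close>. Skipping a single costs
  \<open>k\<close>, covered by its gap 2 since \<open>k \<le> 2\<close>; skipping a double costs 2,
  covered by \<open>2 * k\<close>.\<close>

lemma valid_head_bounds:
  assumes k: "k = 1 \<or> k = 2"
  shows "arranged x ss bs \<Longrightarrow>
    (\<forall>a. valid k (Single a # x) \<longrightarrow> bs \<noteq> [] \<longrightarrow> k * (hd bs + length ss) + 2 \<le> a) \<and>
    (\<forall>b. valid k (Double b # x) \<longrightarrow> ss \<noteq> [] \<longrightarrow> hd ss + 2 * length bs + k + 1 \<le> k * b)"
proof (induction rule: arranged.induct)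
  case (arr_Single x ss bs c)
  show ?case
  proof (intro conjI allI impI)
    fix a assume v: "valid k (Single a # Single (c + 2 * length bs) # x)" and "bs \<noteq> []"
    then have "k * (hd bs + length ss) + 2 \<le> c + 2 * length bs" using arr_Single.IH by simp
    then show "k * (hd bs + length (c # ss)) + 2 \<le> a" using v k by (elim disjE) simp_all
  qed simp
next
  case (arr_Double x ss bs c)
  show ?case
  proof (intro conjI allI impI)
    fix b assume v: "valid k (Double b # Double (c + length ss) # x)" and "ss \<noteq> []"
    then have "hd ss + 2 * length bs + k + 1 \<le> k * (c + length ss)" using arr_Double.IH by simp
    then show "hd ss + 2 * length (c # bs) + k + 1 \<le> k * b" using v k by (elim disjE) simp_all
  qed simp
qed auto

text \<open>If \<open>x\<close> starts with a single, adjacency suffices. If it starts with a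
  double, two comparisons are chained: from the new single to this double, and from there to the
  first single by \<open>valid_head_bounds\<close>.\<close>

lemma valid_Single_bound:
  assumes k: "k = 1 \<or> k = 2" and x: "arranged x ss bs" "spaced 0 ss" "spaced 1 bs"
    and v: "valid k (Single a # x)"
  shows "2 * length bs \<le> a \<and> (ss \<noteq> [] \<longrightarrow> hd ss + 2 + 2 * length bs \<le> a)"
  using x(1)
proof cases
  case (arr_Double x' bs' c)
  have "ss \<noteq> [] \<Longrightarrow> hd ss + 2 * length bs' + k + 1 \<le> k * (c + length ss)"
    using valid_head_bounds[OF k arr_Double(3)] v arr_Double(1) by simp
  moreover have "2 * length bs' + 1 \<le> c"
    using spaced_hd[OF x(3)] arr_Double by simp
  moreover have "k * (c + length ss) + 2 \<le> a" using arr_Double v by simp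
  ultimately show ?thesis using arr_Double(2) k by (elim disjE) auto
qed (use v in auto)

lemma valid_Double_bound:
  assumes k: "k = 1 \<or> k = 2" and x: "arranged x ss bs" "spaced 0 ss" "spaced 1 bs"
    and v: "valid k (Double b # x)"
  shows "length ss + 1 \<le> b \<and> (bs \<noteq> [] \<longrightarrow> hd bs + 2 + length ss \<le> b)"
  using x(1)
proof cases
  case (arr_Single x' ss' c)
  have "bs \<noteq> [] \<Longrightarrow> k * (hd bs + length ss') + 2 \<le> c + 2 * length bs"
    using valid_head_bounds[OF k arr_Single(3)] v arr_Single(1) by simp
  moreover have "2 * length ss' \<le> c"
    using spaced_hd[OF x(2)] arr_Single by simp
  moreover have "c + 2 * length bs + k + 1 \<le> k * b" using arr_Single v by simp
  moreover have "1 \<le> hd bs" if "bs \<noteq> []" using x(3) that by (cases bs) auto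
  ultimately show ?thesis using arr_Single(2) k by (cases "bs = []"; elim disjE) auto
qed (use v in auto)

text \<open>Used for both values of \<open>k\<close>: lists coming from runs and stable lists
  receive invariants of the same form.\<close>

lemma valid_imp_arranged:
  assumes k: "k = 1 \<or> k = 2"
  shows "valid k x \<Longrightarrow> \<exists>ss bs. arranged x ss bs \<and> spaced 0 ss \<and> spaced 1 bs"
proof (induction x)
  case Nil
  have "arranged [] [] [] \<and> spaced 0 [] \<and> spaced 1 []" by (simp add: arr_Nil)
  then show ?case by blast
next
  case (Cons i x)
  then obtain ss bs where x: "arranged x ss bs" "spaced 0 ss" "spaced 1 bs"
    by auto
  show ?case
  proof (cases i)
    case (Single a)
    then have a: "2 * length bs \<le> a \<and> (ss \<noteq> [] \<longrightarrow> hd ss + 2 + 2 * length bs \<le> a)"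
      using valid_Single_bound[OF k x] Cons.prems by blast
    then obtain c where "a = c + 2 * length bs" by (metis le_Suc_ex add.commute)
    then have "arranged (i # x) (c # ss) bs \<and> spaced 0 (c # ss) \<and> spaced 1 bs"
      using x a Single by (auto intro: arr_Single)
    then show ?thesis by blast
  next
    case (Double b)
    then have b: "length ss + 1 \<le> b \<and> (bs \<noteq> [] \<longrightarrow> hd bs + 2 + length ss \<le> b)"
      using valid_Double_bound[OF k x] Cons.prems by blast
    then obtain c where "b = c + length ss" by (metis le_Suc_ex add.commute add_leD1)
    then have "arranged (i # x) ss (c # bs) \<and> spaced 0 ss \<and> spaced 1 (c # bs)"
      using x b Double by (auto intro: arr_Double)
    then show ?thesis by blast
  qed
qed

section \<open>Existence and uniqueness of the valid interleaving\<close>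

lemma arranged_hd:
  "arranged x ss bs \<Longrightarrow> x \<noteq> [] \<Longrightarrow>
    (ss \<noteq> [] \<and> hd x = Single (hd ss + 2 * length bs)) \<or>
    (bs \<noteq> [] \<and> hd x = Double (hd bs + length ss))"
  by (erule arranged.cases) auto

text \<open>Greedy choice of the first block: the conditions for starting with a single and for
  starting with a double are complementary.\<close>

lemma ex_valid_arrangement:
  assumes k: "0 < k"
  shows "spaced 0 ss \<Longrightarrow> spaced 1 bs \<Longrightarrow> \<exists>x. arranged x ss bs \<and> valid k x"
proof (induction "length ss + length bs" arbitrary: ss bs)
  case 0
  then have "arranged [] ss bs \<and> valid k []" by (simp add: arr_Nil)
  then show ?case by blast
next
  case (Suc n)
  consider (S) a ss' where "ss = a # ss'" "bs \<noteq> [] \<Longrightarrow> k * (hd bs + length ss') + 2 \<le> a + 2 * length bs"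
    | (D) b bs' where "bs = b # bs'" "ss \<noteq> [] \<Longrightarrow> hd ss + 2 * length bs' + k + 1 \<le> k * (b + length ss)"
  proof (cases ss; cases bs)
    fix a ss' b bs' assume *: "ss = a # ss'" "bs = b # bs'"
    show ?thesis
    proof (cases "k * (b + length ss') + 2 \<le> a + 2 * length bs")
      case True
      then show ?thesis using S * by simp
    next
      case False
      \<comment> \<open>The negated comparison is a strict inequality of naturals; adding
        \<open>k\<close> for the additional single in \<open>ss\<close> gives the condition for a
        double.\<close>
      then have "a + 2 * length bs' + k + 1 \<le> k * (b + length ss)"
        using * by simp
      then show ?thesis using D * by simp
    qed
  qed (use S D Suc(2) in auto)
  then show ?case
  proof cases
    case S
    then obtain x where x: "arranged x ss' bs" "valid k x"
      using Suc(1)[of ss' bs] Suc(2-) by auto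
    have "valid k (Single (a + 2 * length bs) # x)"
      using arranged_hd[OF x(1)] x(2) S Suc(3) by auto
    then show ?thesis using arr_Single[OF x(1)] S(1) by blast
  next
    case D
    then obtain x where x: "arranged x ss bs'" "valid k x"
      using Suc(1)[of ss bs'] Suc(2-) by auto
    have "valid k (Double (b + length ss) # x)"
      using arranged_hd[OF x(1)] x(2) D Suc(4) by auto
    then show ?thesis using arr_Double[OF x(1)] D(1) by blast
  qed
qed

text \<open>If the first blocks were of different kinds, \<open>valid_head_bounds\<close> would
  yield both of the complementary conditions at once.\<close>

lemma valid_arrangement_unique:
  assumes k: "k = 1 \<or> k = 2"
  shows "arranged x ss bs \<Longrightarrow> arranged y ss bs \<Longrightarrow> valid k x \<Longrightarrow> valid k y \<Longrightarrow> x = y"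
proof (induction arbitrary: y rule: arranged.induct)
  case arr_Nil
  then show ?case by (auto elim: arranged.cases)
next
  case (arr_Single x ss bs a)
  from arr_Single.prems(1) show ?case
  proof cases
    case (arr_Single y')
    then show ?thesis using arr_Single.IH arr_Single.prems by simp
  next
    case (arr_Double y' bs' b)
    have "k * (b + length ss) + 2 \<le> a + 2 * length bs"
      using valid_head_bounds[OF k arr_Single.hyps, THEN conjunct1, rule_format, of "a + 2 * length bs"]
        arr_Single.prems(2) arr_Double(2) by simp
    moreover have "a + 2 * length bs' + k + 1 \<le> k * (b + length (a # ss))"
      using valid_head_bounds[OF k arr_Double(3), THEN conjunct2, rule_format, of "b + length (a # ss)"]
        arr_Single.prems(3) arr_Double(1) by simp
    ultimately show ?thesis using arr_Double by simp
  qed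
next
  case (arr_Double x ss bs b)
  from arr_Double.prems(1) show ?case
  proof cases
    case (arr_Double y')
    then show ?thesis using arr_Double.IH arr_Double.prems by simp
  next
    case (arr_Single y' ss' a)
    have "k * (b + length ss') + 2 \<le> a + 2 * length (b # bs)"
      using valid_head_bounds[OF k arr_Single(3), THEN conjunct1, rule_format, of "a + 2 * length (b # bs)"]
        arr_Double.prems(3) arr_Single(1) by simp
    moreover have "a + 2 * length bs + k + 1 \<le> k * (b + length ss)"
      using valid_head_bounds[OF k arr_Double.hyps, THEN conjunct2, rule_format, of "b + length ss"]
        arr_Double.prems(2) arr_Single(2) by simp
    ultimately show ?thesis using arr_Single by simp
  qed
qed

lemma arranged_functional:
  "arranged x ss bs \<Longrightarrow> arranged x ss' bs' \<Longrightarrow> ss = ss' \<and> bs = bs'"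
proof (induction arbitrary: ss' bs' rule: arranged.induct)
  case (arr_Single x ss bs a)
  from arr_Single.prems show ?case
    by (rule arr_SingleE) (use arr_Single.IH in fastforce)
next
  case (arr_Double x ss bs b)
  from arr_Double.prems show ?case
    by (rule arr_DoubleE) (use arr_Double.IH in fastforce)
qed (auto elim: arr_NilE)

section \<open>Bressoud's map\<close>

lemma interchange_step_Cons:
  "interchange_step ((x1, y1) # p) =
    (if p \<noteq> [] \<and> x1 = y1 + 1 \<and> odd (snd (hd p)) \<and> fst (hd p) = snd (hd p) + 2 \<and> y1 \<le> fst (hd p)
     then Some ((fst (hd p) + 2, fst (hd p)) # (y1 - 1, y1 - 2) # tl p)
     else map_option ((#) (x1, y1)) (interchange_step p))"
  by (cases p) auto

text \<open>The part of adjacency for \<open>k = 2\<close> that interchanges preserve. Equal kinds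
  are handled by the spacing of the invariants, and a single before a double is constrained only
  once no interchange is possible.\<close>

fun loose :: "block \<Rightarrow> block \<Rightarrow> bool" where
  "loose (Double b) (Single a) \<longleftrightarrow> a + 3 \<le> 2 * b"
| "loose _ _ \<longleftrightarrow> True"

text \<open>The difference of each pair is counted with its position, starting from 0. Moving a
  difference 2 ahead of a difference 1 therefore lowers the weight by 1.\<close>

fun weight :: "(nat \<times> nat) list \<Rightarrow> nat" where
  "weight [] = 0"
| "weight (z # p) = (\<Sum>(x, y)\<leftarrow>p. x - y) + weight p"

lemma spaced_mono_hd: "spaced m ss \<Longrightarrow> ss \<noteq> [] \<Longrightarrow> m \<le> hd ss"
  by (cases ss) auto

lemma interchange_step_None_valid:
  "arranged x ss bs \<Longrightarrow> spaced 0 ss \<Longrightarrow> spaced 1 bs \<Longrightarrow> successively loose x \<Longrightarrow>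
    interchange_step (map pair_of x) = None \<Longrightarrow> valid 2 x"
proof (induction rule: arranged.induct)
  case (arr_Single x ss bs a)
  then have v: "valid 2 x"
    by (auto simp: interchange_step_Cons successively_Cons split: if_splits)
  have "fits 2 (Single (a + 2 * length bs)) (hd x)" if "x \<noteq> []"
    using arranged_hd[OF arr_Single.hyps that]
  proof
    assume *: "bs \<noteq> [] \<and> hd x = Double (hd bs + length ss)"
    \<comment> \<open>Then \<open>2 * b - 1\<close> is not truncated, so the double passes the shape
      test of \<open>interchange_step\<close> and only the size comparison can have failed.\<close>
    then have "1 \<le> hd bs" using spaced_mono_hd arr_Single.prems(2) by blast
    then show ?thesis using arr_Single.prems * that
      by (auto simp: interchange_step_Cons hd_map split: if_splits)
  qed (use arr_Single.prems in auto)
  then show ?case using v by simp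
next
  case (arr_Double x ss bs b)
  then have v: "valid 2 x"
    by (auto simp: interchange_step_Cons successively_Cons split: if_splits)
  have "fits 2 (Double (b + length ss)) (hd x)" if "x \<noteq> []"
    using arranged_hd[OF arr_Double.hyps that] arr_Double.prems that
    by (auto simp: successively_Cons)
  then show ?case using v arr_Double.prems by simp
qed simp

text \<open>The double gains a single on its right and the single loses a double, matching the
  changes of \<open>b\<close> by 1 and of \<open>a\<close> by 2. The clause on \<open>hd x'\<close>
  keeps a preceding double loose; the equality of total differences lets the weight decrease survive
  a new front pair.\<close>

lemma interchange_step_Some:
  "arranged x ss bs \<Longrightarrow> spaced 0 ss \<Longrightarrow> spaced 1 bs \<Longrightarrow> successively loose x \<Longrightarrow>
    interchange_step (map pair_of x) = Some p \<Longrightarrow>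
    \<exists>x'. p = map pair_of x' \<and> arranged x' ss bs \<and> successively loose x' \<and> x' \<noteq> [] \<and>
      (hd x' = hd x \<or> (\<exists>b. hd x' = Double b)) \<and>
      (\<Sum>(x, y)\<leftarrow>p. x - y) = (\<Sum>(x, y)\<leftarrow>map pair_of x. x - y) \<and>
      weight p < weight (map pair_of x)"
proof (induction arbitrary: p rule: arranged.induct)
  case (arr_Single x ss bs a)
  let ?a = "a + 2 * length bs"
  show ?case
  proof (cases "x \<noteq> [] \<and> odd (snd (pair_of (hd x))) \<and> fst (pair_of (hd x)) = snd (pair_of (hd x)) + 2 \<and> ?a \<le> fst (pair_of (hd x))")
    case True
    with arr_Single.hyps show ?thesis
    proof cases
      case (arr_Double x0 bs0 b)
      \<comment> \<open>The interchange condition \<open>?a \<le> 2 * (b + length ss) + 1\<close> is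
        precisely looseness of the two swapped blocks.\<close>
      let ?x' = "Double (b + length (a # ss)) # Single (a + 2 * length bs0) # x0"
      have "1 \<le> b" using arr_Single.prems(2) arr_Double by simp
      have "arranged ?x' (a # ss) bs"
        using arr_Double arranged.intros by metis
      moreover have "p = map pair_of ?x'"
        using arr_Single.prems(4) arr_Double True \<open>1 \<le> b\<close> by (auto simp: interchange_step_Cons)
      moreover have "successively loose ?x'"
        using arr_Single.prems(3) arr_Double True by (auto simp: successively_Cons)
      ultimately show ?thesis
        using \<open>1 \<le> b\<close> by (intro exI[of _ ?x']) (auto simp: arr_Double(1,2))
    qed auto
  next
    case False
    then have "interchange_step (map pair_of (Single ?a # x)) =
        map_option ((#) (?a + 1, ?a)) (interchange_step (map pair_of x))"
      by (auto simp: interchange_step_Cons hd_map)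
    then obtain q where q: "interchange_step (map pair_of x) = Some q" "p = (?a + 1, ?a) # q"
      using arr_Single.prems(4) by auto
    then obtain x' where "q = map pair_of x' \<and> arranged x' ss bs \<and> successively loose x' \<and> x' \<noteq> [] \<and>
      (hd x' = hd x \<or> (\<exists>b. hd x' = Double b)) \<and>
      (\<Sum>(x, y)\<leftarrow>q. x - y) = (\<Sum>(x, y)\<leftarrow>map pair_of x. x - y) \<and>
      weight q < weight (map pair_of x)"
      using arr_Single.IH[of q] arr_Single.prems by (auto simp: successively_Cons)
    then show ?thesis using q(2) arranged.arr_Single[of x' ss bs a]
      by (intro exI[of _ "Single ?a # x'"]) (auto simp: successively_Cons)
  qed
next
  case (arr_Double x ss bs b)
  let ?b = "b + length ss"
  have b: "1 \<le> ?b" using arr_Double.prems by simp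
  then have "interchange_step (map pair_of (Double ?b # x)) =
        map_option ((#) (pair_of (Double ?b))) (interchange_step (map pair_of x))"
    by (auto simp: interchange_step_Cons hd_map)
  then obtain q where q: "interchange_step (map pair_of x) = Some q" "p = pair_of (Double ?b) # q"
    using arr_Double.prems(4) by auto
  then have "x \<noteq> []" by auto
  obtain x' where x': "q = map pair_of x' \<and> arranged x' ss bs \<and> successively loose x' \<and> x' \<noteq> [] \<and>
      (hd x' = hd x \<or> (\<exists>b. hd x' = Double b)) \<and>
      (\<Sum>(x, y)\<leftarrow>q. x - y) = (\<Sum>(x, y)\<leftarrow>map pair_of x. x - y) \<and>
      weight q < weight (map pair_of x)"
    using arr_Double.IH[of q] q arr_Double.prems by (auto simp: successively_Cons)
  then have "loose (Double ?b) (hd x')"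
    using arr_Double.prems(3) \<open>x \<noteq> []\<close> by (auto simp: successively_Cons)
  then show ?case using x' q(2) arranged.arr_Double[of x' ss bs b]
    by (intro exI[of _ "Double ?b # x'"]) (auto simp: successively_Cons)
qed simp

lemma valid_1_loose: "valid 1 x \<Longrightarrow> successively loose x"
proof (induction x)
  case (Cons i x)
  have "loose i (hd x)" if "x \<noteq> []"
    using Cons.prems that by (cases i; cases "hd x") auto
  then show ?case using Cons by (cases "x = []") (simp_all add: successively_Cons)
qed simp

text \<open>The decreasing weight makes the loop terminate, so \<open>the\<close> is applied to an
  actual result, and its stopping condition upgrades looseness to validity for
  \<open>k = 2\<close>.\<close>

lemma interchange_all_arranged:
  assumes "valid 1 x" "arranged x ss bs" "spaced 0 ss" "spaced 1 bs"
  shows "\<exists>y. interchange_all (map pair_of x) = map pair_of y \<and> arranged y ss bs \<and> valid 2 y"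
proof -
  let ?P = "\<lambda>p. \<exists>y. p = map pair_of y \<and> arranged y ss bs \<and> successively loose y"
  have start: "?P (map pair_of x)" using assms valid_1_loose by blast
  have step: "?P (the (interchange_step p)) \<and> weight (the (interchange_step p)) < weight p"
    if "?P p" "interchange_step p \<noteq> None" for p
  proof -
    from that obtain y where y: "p = map pair_of y" "arranged y ss bs" "successively loose y" by blast
    from that obtain q where q: "interchange_step p = Some q" by blast
    show ?thesis using interchange_step_Some[OF y(2) assms(3,4) y(3), of q] q y(1) by auto
  qed
  obtain p where p: "while_option (\<lambda>p. interchange_step p \<noteq> None) (\<lambda>p. the (interchange_step p)) (map pair_of x) = Some p"
    using measure_while_option_Some[of ?P "\<lambda>p. interchange_step p \<noteq> None" "\<lambda>p. the (interchange_step p)" weight, OF step start]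
    by blast
  have "?P p" by (rule while_option_rule[where P = ?P, OF _ p start]) (use step in blast)
  then obtain y where y: "p = map pair_of y" "arranged y ss bs" "successively loose y" by blast
  moreover have "interchange_step p = None" using while_option_stop[OF p] by simp
  ultimately have "valid 2 y" using interchange_step_None_valid assms(3,4) by blast
  then show ?thesis using y p by (auto simp: interchange_all_def)
qed

section \<open>Distinct odd partitions as lists of blocks\<close>

fun parts_of :: "block list \<Rightarrow> nat list" where
  "parts_of [] = []"
| "parts_of (Single a # x) = (2 * a + 1) # parts_of x"
| "parts_of (Double b # x) = (2 * b + 1) # (2 * b - 1) # parts_of x"

lemma runs_Cons: "\<exists>g gs. runs (d # r) = (d # g) # gs"
  by (cases r) (auto split: list.splits)

text \<open>Pairs are formed from the largest term of a run, so one pass from the left suffices: an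
  entry is paired with a successor smaller by 2, and any other entry ends its run.\<close>

lemma initial_pairs_simps:
  "initial_pairs [] = []"
  "initial_pairs [c] = [((c + 1) div 2, (c - 1) div 2)]"
  "initial_pairs (c # d # r) =
    (if c = d + 2 then (c, d) # initial_pairs r
     else ((c + 1) div 2, (c - 1) div 2) # initial_pairs (d # r))"
proof -
  show "initial_pairs (c # d # r) =
    (if c = d + 2 then (c, d) # initial_pairs r
     else ((c + 1) div 2, (c - 1) div 2) # initial_pairs (d # r))"
  proof (cases r)
    case Nil
    then show ?thesis by (simp add: initial_pairs_def)
  next
    case (Cons e r')
    obtain g gs where "runs (e # r') = (e # g) # gs" using runs_Cons by blast
    then show ?thesis by (auto simp: initial_pairs_def Cons)
  qed
qed (simp_all add: initial_pairs_def)

lemma parts_of_hd: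
  "x \<noteq> [] \<Longrightarrow> parts_of x \<noteq> [] \<and> hd (parts_of x) = (case hd x of Single a \<Rightarrow> 2 * a + 1 | Double b \<Rightarrow> 2 * b + 1)"
  by (cases x rule: parts_of.cases) auto

lemma sorted_wrt_greater_Cons:
  "sorted_wrt (>) (a # xs) \<longleftrightarrow> (xs \<noteq> [] \<longrightarrow> hd xs < a) \<and> sorted_wrt (>) (xs :: nat list)"
  by (cases xs) auto

text \<open>A single is one part split into halves of difference 1, a double consists of two parts
  of difference 2; so the differences add up to the number of parts.\<close>

lemma valid_1_parts_of:
  "valid 1 x \<Longrightarrow> sorted_wrt (>) (parts_of x) \<and> (\<forall>z\<in>set (parts_of x). odd z) \<and>
    initial_pairs (parts_of x) = map pair_of x \<and>
    sum_list (parts_of x) = pair_sum (map pair_of x) \<and>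
    int (length (parts_of x)) = pair_alt (map pair_of x)"
proof (induction x rule: parts_of.induct)
  case 1
  then show ?case by (simp add: initial_pairs_simps)
next
  case (2 a x)
  \<comment> \<open>The gap exceeds 2, so the part \<open>2 * a + 1\<close> ends its run and is
    split alone.\<close>
  have "hd (parts_of x) + 2 < 2 * a + 1" if "x \<noteq> []"
    using 2(2) that parts_of_hd[OF that] by (cases "hd x") auto
  moreover have "initial_pairs (parts_of (Single a # x)) = (a + 1, a) # initial_pairs (parts_of x)"
    using calculation by (cases "parts_of x"; cases x rule: parts_of.cases) (auto simp: initial_pairs_simps)
  moreover have "valid 1 x" using 2(2) by simp
  ultimately show ?case using 2(1)
    by (cases "x = []") (auto simp: sorted_wrt_greater_Cons simp del: sorted_wrt.simps(2))
next
  case (3 b x)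
  have "hd (parts_of x) < 2 * b - 1" if "x \<noteq> []"
    using 3(2) that parts_of_hd[OF that] by (cases "hd x") auto
  moreover have "valid 1 x" "b > 0" using 3(2) by simp_all
  ultimately show ?case using 3(1)
    by (cases "x = []") (auto simp: sorted_wrt_greater_Cons initial_pairs_simps simp del: sorted_wrt.simps(2))
qed

lemma ex_parts_of:
  "sorted_wrt (>) \<beta> \<Longrightarrow> \<forall>z\<in>set \<beta>. odd z \<Longrightarrow> \<exists>x. valid 1 x \<and> parts_of x = \<beta>"
proof (induction \<beta> rule: length_induct)
  case (1 \<beta>)
  consider "\<beta> = []" | c where "\<beta> = [c]" | c d r where "\<beta> = c # d # r"
    by (cases \<beta> rule: pairs_of.cases)
  then show ?case
  proof cases
    case 1
    then show ?thesis by (intro exI[of _ "[]"]) simp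
  next
    case (2 c)
    then show ?thesis using 1 by (intro exI[of _ "[Single (c div 2)]"]) (auto elim!: oddE)
  next
    case (3 c d r)
    have "odd c" "odd d" "d < c" using 1 3 by auto
    then obtain a b where ab: "c = 2 * a + 1" "d = 2 * b + 1" by (auto elim!: oddE)
    show ?thesis
    proof (cases "c = d + 2")
      case True
      obtain x where x: "valid 1 x" "parts_of x = r"
        using 1(1)[rule_format, of r] 1(2,3) 3 by auto
      have "fits 1 (Double (b + 1)) (hd x)" if "x \<noteq> []"
      proof -
        have "hd r \<in> set r" using parts_of_hd[OF that, THEN conjunct1] x(2) by auto
        then have "hd r < d" using 1(2) 3 by auto
        then show ?thesis using parts_of_hd[OF that] x(2) ab by (cases "hd x") auto
      qed
      then have "valid 1 (Double (b + 1) # x) \<and> parts_of (Double (b + 1) # x) = \<beta>"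
        using x True ab 3 by simp
      then show ?thesis by blast
    next
      case False
      obtain x where x: "valid 1 x" "parts_of x = d # r"
        using 1(1)[rule_format, of "d # r"] 1(2,3) 3 by auto
      have "fits 1 (Single a) (hd x)" if "x \<noteq> []"
        using parts_of_hd[OF that] x(2) ab False \<open>d < c\<close> by (cases "hd x") auto
      then have "valid 1 (Single a # x) \<and> parts_of (Single a # x) = \<beta>"
        using x ab 3 by simp
      then show ?thesis by blast
    qed
  qed
qed

section \<open>Stable block lists and reduced pair lists\<close>

lemma valid_no_zero: "valid k x \<Longrightarrow> Double 0 \<notin> set x"
  by (induction x) auto

lemma inj_on_pair_of: "inj_on pair_of (- {Double 0})"
proof (rule inj_onI)
  fix i j assume "i \<in> - {Double 0}" "j \<in> - {Double 0}" "pair_of i = pair_of j"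
  then show "i = j" by (cases i; cases j) auto
qed

lemma map_pair_of_inj:
  assumes "valid k x" "valid l y" "map pair_of x = map pair_of y"
  shows "x = y"
proof -
  have "inj_on pair_of (set x \<union> set y)"
    using valid_no_zero[OF assms(1)] valid_no_zero[OF assms(2)]
    by (intro inj_on_subset[OF inj_on_pair_of]) auto
  then show ?thesis using assms(3) inj_on_map_eq_map by blast
qed

lemma valid_2_decr: "valid 2 x \<Longrightarrow> decr (map pair_of x) \<and> reduced (map pair_of x)"
proof (induction x)
  case (Cons i x)
  have "fst (pair_of (hd x)) < snd (pair_of i)" if "x \<noteq> []"
    using Cons.prems that by (cases i; cases "hd x") auto
  then show ?case using Cons by (cases i) (auto simp: hd_map)
qed simp

text \<open>Together with \<open>valid_2_decr\<close> this identifies stable block lists with what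
  remains of a strict partition when nothing can be removed.\<close>

lemma reduced_imp_valid_2: "decr p \<Longrightarrow> reduced p \<Longrightarrow> \<exists>x. valid 2 x \<and> map pair_of x = p"
proof (induction p)
  case Nil
  then show ?case by (intro exI[of _ "[]"]) simp
next
  case (Cons z p)
  obtain a b where z: "z = (a, b)" by (cases z)
  obtain x where x: "valid 2 x" "map pair_of x = p"
    using Cons by (auto simp: z)
  have hd: "fst (pair_of (hd x)) < b" if "x \<noteq> []"
    using Cons.prems(1) x(2) that by (auto simp: z hd_map)
  show ?case
  proof (cases "a = b + 1")
    case True
    have "fits 2 (Single b) (hd x)" if "x \<noteq> []"
      using hd[OF that] by (cases "hd x") auto
    then have "valid 2 (Single b # x) \<and> map pair_of (Single b # x) = z # p"
      using x True by (simp add: z)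
    then show ?thesis by (rule exI)
  next
    case False
    then have ab: "a = b + 2" "odd a" using Cons.prems by (auto simp: z)
    then obtain c where "a = 2 * c + 1" by (elim oddE)
    with ab have c: "a = 2 * c + 1" "b = 2 * c - 1" "0 < c" by simp_all
    have "fits 2 (Double c) (hd x)" if "x \<noteq> []"
      using hd[OF that] c by (cases "hd x") auto
    then have "valid 2 (Double c # x) \<and> map pair_of (Double c # x) = z # p"
      using x c by (simp add: z)
    then show ?thesis by (rule exI)
  qed
qed

text \<open>A single and a double contribute 4 to the sum through their mutual position, whichever
  comes first: either \<open>a\<close> grows by 2 or \<open>b\<close> grows by 1. Hence the
  statistics depend only on \<open>ss\<close> and \<open>bs\<close>.\<close>

lemma arranged_stats:
  "arranged x ss bs \<Longrightarrow> spaced 1 bs \<Longrightarrow>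
    pair_sum (map pair_of x) = (\<Sum>a\<leftarrow>ss. 2 * a + 1) + 4 * sum_list bs + 4 * length ss * length bs \<and>
    pair_alt (map pair_of x) = int (length ss + 2 * length bs) \<and>
    pair_odd (map pair_of x) = length ss + 2 * length bs"
  by (induction rule: arranged.induct) (auto simp: algebra_simps)

section \<open>Statistics and bijectivity of Bressoud's map\<close>

abbreviation distinct_odd :: "nat list \<Rightarrow> bool" where
  "distinct_odd \<beta> \<equiv> sorted_wrt (>) \<beta> \<and> (\<forall>z\<in>set \<beta>. odd z)"

definition bressoud_pairs :: "nat list \<Rightarrow> (nat \<times> nat) list" where
  "bressoud_pairs \<beta> = interchange_all (initial_pairs \<beta>)"

lemma bressoud_eq: "bressoud \<beta> = unpair (bressoud_pairs \<beta>)"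
  by (simp add: bressoud_def unpair_def bressoud_pairs_def)

lemma bressoud_pairs_ex:
  assumes "distinct_odd \<beta>"
  shows "\<exists>x y ss bs. valid 1 x \<and> parts_of x = \<beta> \<and> arranged x ss bs \<and> spaced 0 ss \<and> spaced 1 bs \<and>
    arranged y ss bs \<and> valid 2 y \<and> bressoud_pairs \<beta> = map pair_of y"
proof -
  obtain x where x: "valid 1 x" "parts_of x = \<beta>" using ex_parts_of assms by blast
  obtain ss bs where s: "arranged x ss bs" "spaced 0 ss" "spaced 1 bs"
    using valid_imp_arranged[OF _ x(1)] by auto
  have "initial_pairs \<beta> = map pair_of x" using valid_1_parts_of[OF x(1)] x(2) by simp
  then show ?thesis
    using interchange_all_arranged[OF x(1) s] x s unfolding bressoud_pairs_def by metis
qed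

lemma bressoud_pairs_props:
  assumes "distinct_odd \<beta>"
  shows "decr (bressoud_pairs \<beta>)" "reduced (bressoud_pairs \<beta>)"
    "pair_sum (bressoud_pairs \<beta>) = sum_list \<beta>"
    "pair_alt (bressoud_pairs \<beta>) = int (length \<beta>)"
    "pair_odd (bressoud_pairs \<beta>) = length \<beta>"
proof -
  obtain x y ss bs where *: "valid 1 x" "parts_of x = \<beta>" "arranged x ss bs" "spaced 0 ss" "spaced 1 bs"
    "arranged y ss bs" "valid 2 y" "bressoud_pairs \<beta> = map pair_of y"
    using bressoud_pairs_ex[OF assms] by blast
  show "decr (bressoud_pairs \<beta>)" "reduced (bressoud_pairs \<beta>)"
    using valid_2_decr[OF *(7)] *(8) by auto
  have "int (length \<beta>) = int (length ss + 2 * length bs)"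
    using arranged_stats[OF *(3,5)] valid_1_parts_of[OF *(1)] *(2) by simp
  then show "pair_sum (bressoud_pairs \<beta>) = sum_list \<beta>" "pair_alt (bressoud_pairs \<beta>) = int (length \<beta>)"
    "pair_odd (bressoud_pairs \<beta>) = length \<beta>"
    using arranged_stats[OF *(3,5)] arranged_stats[OF *(6,5)] valid_1_parts_of[OF *(1)] *(2,8) by simp_all
qed

text \<open>The image determines the invariants, and these have only one interleaving valid for
  \<open>k = 1\<close>.\<close>

lemma bressoud_pairs_inj:
  assumes "distinct_odd \<beta>" "distinct_odd \<gamma>" "bressoud_pairs \<beta> = bressoud_pairs \<gamma>"
  shows "\<beta> = \<gamma>"
proof -
  obtain x y ss bs where *: "valid 1 x" "parts_of x = \<beta>" "arranged x ss bs"
    "arranged y ss bs" "valid 2 y" "bressoud_pairs \<beta> = map pair_of y"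
    using bressoud_pairs_ex[OF assms(1)] by blast
  obtain x' y' ss' bs' where **: "valid 1 x'" "parts_of x' = \<gamma>" "arranged x' ss' bs'"
    "arranged y' ss' bs'" "valid 2 y'" "bressoud_pairs \<gamma> = map pair_of y'"
    using bressoud_pairs_ex[OF assms(2)] by blast
  have "y = y'" using map_pair_of_inj[OF *(5) **(5)] *(6) **(6) assms(3) by simp
  then have "ss = ss'" "bs = bs'" using arranged_functional *(4) **(4) by blast+
  then have "x = x'" using valid_arrangement_unique[of 1] *(1,3) **(1,3) by auto
  then show ?thesis using * ** by simp
qed

text \<open>No interchange is reversed. The invariants of the given stable list are rearranged
  validly for \<open>k = 1\<close>; the map sends this to a stable list with the same invariants,
  which by uniqueness is the given one.\<close>

lemma bressoud_pairs_surj: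
  assumes "decr p" "reduced p"
  shows "\<exists>\<beta>. distinct_odd \<beta> \<and> bressoud_pairs \<beta> = p"
proof -
  obtain y where y: "valid 2 y" "map pair_of y = p" using reduced_imp_valid_2[OF assms] by blast
  obtain ss bs where s: "arranged y ss bs" "spaced 0 ss" "spaced 1 bs"
    using valid_imp_arranged[OF _ y(1)] by auto
  obtain x where x: "arranged x ss bs" "valid 1 x" using ex_valid_arrangement[of 1] s(2,3) by auto
  obtain y' where y': "interchange_all (map pair_of x) = map pair_of y'" "arranged y' ss bs" "valid 2 y'"
    using interchange_all_arranged[OF x(2,1) s(2,3)] by blast
  have "y' = y" using valid_arrangement_unique[of 2] y'(2,3) y(1) s(1) by auto
  then have "bressoud_pairs (parts_of x) = p"
    using valid_1_parts_of[OF x(2)] y'(1) y(2) by (simp add: bressoud_pairs_def)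
  then show ?thesis using valid_1_parts_of[OF x(2)] by blast
qed

section \<open>The extended map\<close>

definition insert_all :: "(nat \<times> nat) list \<Rightarrow> nat list \<Rightarrow> (nat \<times> nat) list" where
  "insert_all p as = foldl (\<lambda>p a. pair_insert a p) p as"

lemma insert_all_simps [simp]:
  "insert_all p [] = p"
  "insert_all p (as @ [a]) = pair_insert a (insert_all p as)"
  by (simp_all add: insert_all_def)

abbreviation decreasing_pos :: "nat list \<Rightarrow> bool" where
  "decreasing_pos as \<equiv> sorted_wrt (\<ge>) as \<and> (\<forall>a\<in>set as. 1 \<le> a)"

lemma decreasing_pos_snoc:
  "decreasing_pos (as @ [a]) \<longleftrightarrow> decreasing_pos as \<and> 1 \<le> a \<and> (as = [] \<or> a \<le> last as)"
  by (cases as rule: rev_cases) (auto simp: sorted_wrt_append)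

text \<open>The largest bound that holds is the last value inserted, so a next value in weakly
  decreasing order always meets the hypothesis of \<open>decr_pair_insert\<close>.\<close>

lemma insert_all_removal_bound:
  assumes "decr p" "reduced p"
  shows "decreasing_pos as \<Longrightarrow> decr (insert_all p as) \<and>
    (\<forall>b. removal_bound b (insert_all p as) \<longleftrightarrow> as = [] \<or> b \<le> last as)"
proof (induction as rule: rev_induct)
  case Nil
  then show ?case using assms reduced_removal_bound by simp
next
  case (snoc a as)
  have as: "decreasing_pos as" "1 \<le> a" "as = [] \<or> a \<le> last as"
    using snoc.prems unfolding decreasing_pos_snoc by blast+
  then have "decr (insert_all p as)" "removal_bound a (insert_all p as)" using snoc.IH by auto
  then show ?case using decr_pair_insert[OF as(2)] removal_bound_pair_insert_iff[OF as(2)] by simp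
qed

lemma insert_all_stats:
  "\<forall>a\<in>set as. 1 \<le> a \<Longrightarrow>
    pair_sum (insert_all p as) = pair_sum p + (\<Sum>a\<leftarrow>as. 4 * a - 2) \<and>
    pair_alt (insert_all p as) = pair_alt p + 2 * int (length as) \<and>
    pair_odd (insert_all p as) = pair_odd p"
  by (induction as rule: rev_induct) (simp_all add: pair_sum_pair_insert pair_alt_pair_insert pair_odd_pair_insert)

text \<open>The bounds that hold for the result reveal the last value inserted, or, if all hold,
  that nothing was inserted; \<open>pair_insert_inj\<close> then undoes the last step.\<close>

lemma insert_all_inj:
  assumes p: "decr p" "reduced p" and q: "decr q" "reduced q"
  shows "decreasing_pos as \<Longrightarrow> decreasing_pos bs \<Longrightarrow> insert_all p as = insert_all q bs \<Longrightarrow> p = q \<and> as = bs"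
proof (induction as arbitrary: bs rule: rev_induct)
  case Nil
  have "bs = []"
  proof (rule ccontr)
    assume "bs \<noteq> []"
    then show False using insert_all_removal_bound[OF q Nil(2)] insert_all_removal_bound[OF p Nil(1)] Nil(3)
      by (metis Suc_n_not_le_n)
  qed
  then show ?case using Nil by simp
next
  case (snoc a as)
  show ?case
  proof (cases bs rule: rev_cases)
    case Nil
    then show ?thesis using insert_all_removal_bound[OF q, of bs] insert_all_removal_bound[OF p snoc(2)] snoc(3,4)
      by (metis Suc_n_not_le_n last_snoc snoc_eq_iff_butlast)
  next
    case (snoc bs' b)
    have removal_bound: "removal_bound c (insert_all p (as @ [a])) \<longleftrightarrow> c \<le> a" "removal_bound c (insert_all q (bs' @ [b])) \<longleftrightarrow> c \<le> b" for c
      using insert_all_removal_bound[OF p snoc.prems(1)] insert_all_removal_bound[OF q snoc.prems(2)] snoc by auto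
    then have "a = b" using snoc.prems(3) snoc by (metis le_antisym order_refl)
    have dec: "decreasing_pos as" "decreasing_pos bs'" "1 \<le> a" "as = [] \<or> a \<le> last as" "bs' = [] \<or> b \<le> last bs'"
      using snoc.prems(1,2) unfolding snoc decreasing_pos_snoc by blast+
    have "insert_all p as = insert_all q bs'"
      by (rule pair_insert_inj[of a])
        (use dec insert_all_removal_bound[OF p dec(1)] insert_all_removal_bound[OF q dec(2)] snoc.prems(3) snoc \<open>a = b\<close> in auto)
    then show ?thesis using snoc.IH[OF dec(1,2)] snoc \<open>a = b\<close> by simp
  qed
qed

lemma insert_all_surj:
  "decr p \<Longrightarrow> \<exists>q as. decr q \<and> reduced q \<and> decreasing_pos as \<and> insert_all q as = p"
proof (induction "pair_sum p" arbitrary: p rule: less_induct)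
  case less
  show ?case
  proof (cases "reduced p")
    case True
    then have "decr p \<and> reduced p \<and> decreasing_pos [] \<and> insert_all p [] = p" using less by simp
    then show ?thesis by blast
  next
    case False
    then obtain a q where a: "1 \<le> a" "decr q" "removal_bound a q" "pair_insert a q = p"
      using pair_insert_surj less.prems by blast
    then have "pair_sum q < pair_sum p" using pair_sum_pair_insert[OF a(1), of q] by simp
    then obtain q0 as where q: "decr q0" "reduced q0" "decreasing_pos as" "insert_all q0 as = q"
      using less.hyps a(2) by blast
    \<comment> \<open>The bound on \<open>q\<close> says exactly that \<open>a\<close> may follow
      the earlier values in decreasing order.\<close>
    then have "as = [] \<or> a \<le> last as" using insert_all_removal_bound[OF q(1-3)] a(3) by auto
    then have "decreasing_pos (as @ [a])"
      using q(3) a(1) unfolding decreasing_pos_snoc by blast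
    moreover have "insert_all q0 (as @ [a]) = p" using q(4) a(4) by simp
    ultimately show ?thesis using q(1,2) by blast
  qed
qed

section \<open>Splitting an odd partition into \<open>\<alpha>\<close> and
  \<open>\<beta>\<close>\<close>

lemma sorted_wrt_ge_eqI:
  fixes xs ys :: "nat list"
  assumes "sorted_wrt (\<ge>) xs" "sorted_wrt (\<ge>) ys" "\<And>i. count_list xs i = count_list ys i"
  shows "xs = ys"
proof -
  have "mset (rev xs) = mset (rev ys)" using assms(3) by (intro multiset_eqI) (simp add: count_mset)
  moreover have "sorted (rev xs)" "sorted (rev ys)" using assms(1,2) by (simp_all add: sorted_wrt_rev)
  ultimately have "rev xs = rev ys" by (metis properties_for_sort)
  then show ?thesis by simp
qed

lemma count_list_replicate: "count_list (replicate k x) i = (if i = x then k else 0)"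
  by (induction k) auto

lemma count_list_concat_replicate:
  "distinct L \<Longrightarrow> count_list (concat (map (\<lambda>i. replicate (f i) i) L)) i = (if i \<in> set L then f i else 0)"
  by (induction L) (auto simp: count_list_replicate)

lemma count_list_alpha_part: "count_list (alpha_part lam) i = count_list lam i div 2"
  unfolding alpha_part_def
  by (subst count_list_concat_replicate) (auto simp: count_list_0_iff)

lemma sorted_wrt_ge_replicate: "sorted_wrt (\<ge>) (replicate k (x :: nat))"
  by (induction k) auto

lemma sorted_wrt_ge_concat_replicate:
  "sorted_wrt (\<ge>) L \<Longrightarrow> sorted_wrt (\<ge>) (concat (map (\<lambda>i. replicate (f i) (i::nat)) L))"
  by (induction L) (auto simp: sorted_wrt_append sorted_wrt_ge_replicate)

lemma sorted_wrt_rev_sorted_list_of_set: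
  "sorted_wrt (>) (rev (sorted_list_of_set (S :: nat set)))"
  by (simp add: sorted_wrt_rev)

lemma sorted_wrt_greater_imp_ge: "sorted_wrt (>) (xs :: nat list) \<Longrightarrow> sorted_wrt (\<ge>) xs"
  by (erule sorted_wrt_mono_rel[rotated]) simp

lemma alpha_part_sorted: "sorted_wrt (\<ge>) (alpha_part lam)"
  unfolding alpha_part_def
  by (intro sorted_wrt_ge_concat_replicate sorted_wrt_greater_imp_ge sorted_wrt_rev_sorted_list_of_set)

lemma beta_part_sorted: "sorted_wrt (>) (beta_part lam)"
  unfolding beta_part_def by (rule sorted_wrt_rev_sorted_list_of_set)

lemma set_beta_part: "set (beta_part lam) = {i. odd (count_list lam i)}"
proof -
  have "i \<in> set lam" if "odd (count_list lam i)" for i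
    using that by (metis count_list_0_iff dvd_0_right)
  then show ?thesis unfolding beta_part_def by auto
qed

lemma count_list_distinct: "distinct xs \<Longrightarrow> count_list xs i = (if i \<in> set xs then 1 else 0)"
  by (induction xs) auto

lemma sorted_wrt_greater_distinct: "sorted_wrt (>) (xs :: nat list) \<Longrightarrow> distinct xs"
  by (induction xs) auto

lemma count_list_beta_part: "count_list (beta_part lam) i = count_list lam i mod 2"
  using count_list_distinct[OF sorted_wrt_greater_distinct[OF beta_part_sorted]]
  by (simp add: set_beta_part odd_iff_mod_2_eq_one)

lemma mset_alpha_beta: "mset (alpha_part lam @ alpha_part lam @ beta_part lam) = mset lam"
proof (rule multiset_eqI)
  fix i
  have "c div 2 + (c div 2 + c mod 2) = c" for c :: nat by presburger
  then show "count (mset (alpha_part lam @ alpha_part lam @ beta_part lam)) i = count (mset lam) i"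
    by (simp add: count_mset count_list_alpha_part count_list_beta_part)
qed

lemma set_alpha_part: "set (alpha_part lam) \<subseteq> set lam"
  unfolding alpha_part_def by auto

definition decomposition :: "nat list \<Rightarrow> nat list \<times> nat list" where
  "decomposition lam = (map (\<lambda>x. (x + 1) div 2) (alpha_part lam), beta_part lam)"

text \<open>The first component records \<open>a\<close> for the part \<open>2 * a - 1\<close> of
  \<open>\<alpha>\<close>, so \<open>4 * a - 2\<close> is the size of its two copies.\<close>

definition decompositions :: "nat \<Rightarrow> (nat list \<times> nat list) set" where
  "decompositions n = {(as, \<beta>). decreasing_pos as \<and> distinct_odd \<beta> \<and> (\<Sum>a\<leftarrow>as. 4 * a - 2) + sum_list \<beta> = n}"

lemma odd_partsD:
  assumes "lam \<in> odd_parts n"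
  shows "sorted_wrt (\<ge>) lam" "\<forall>x\<in>set lam. odd x" "sum_list lam = n"
  using assms by (auto simp: odd_parts_def is_partition_def)

lemma sum_list_halves: "\<forall>x\<in>set xs. odd x \<Longrightarrow> (\<Sum>a\<leftarrow>map (\<lambda>x. (x + 1) div 2) xs. 4 * a - 2) = 2 * sum_list (xs :: nat list)"
  by (induction xs) (auto elim!: oddE)

lemma map_halves: "\<forall>x\<in>set xs. odd x \<Longrightarrow> map (\<lambda>a. 2 * a - 1) (map (\<lambda>x. (x + 1) div 2) xs) = (xs :: nat list)"
  by (induction xs) (auto elim!: oddE)

lemma decomposition_in:
  assumes "lam \<in> odd_parts n"
  shows "decomposition lam \<in> decompositions n"
proof -
  note lam = odd_partsD[OF assms]
  have \<alpha>: "\<forall>x\<in>set (alpha_part lam). odd x" using lam(2) set_alpha_part by blast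
  have "sorted_wrt (\<ge>) (map (\<lambda>x. (x + 1) div 2) (alpha_part lam))"
    unfolding sorted_wrt_map by (rule sorted_wrt_mono_rel[OF _ alpha_part_sorted]) (simp add: div_le_mono)
  moreover have "\<forall>x\<in>set (beta_part lam). odd x"
    using lam(2) unfolding beta_part_def by simp
  moreover have "2 * sum_list (alpha_part lam) + sum_list (beta_part lam) = n"
    using arg_cong[OF mset_alpha_beta[of lam], of sum_mset] lam(3)
    by (simp add: sum_mset_sum_list del: mset_append)
  moreover have "\<forall>a\<in>set (map (\<lambda>x. (x + 1) div 2) (alpha_part lam)). 1 \<le> a"
    using \<alpha> by (auto elim!: oddE)
  ultimately show ?thesis
    using sum_list_halves[OF \<alpha>] beta_part_sorted
    by (simp add: decomposition_def decompositions_def)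
qed

lemma bij_betw_decomposition: "bij_betw decomposition (odd_parts n) (decompositions n)"
proof (rule bij_betw_imageI)
  show "inj_on decomposition (odd_parts n)"
  proof (rule inj_onI)
    fix lam mu assume *: "lam \<in> odd_parts n" "mu \<in> odd_parts n" "decomposition lam = decomposition mu"
    note lam = odd_partsD[OF *(1)] and mu = odd_partsD[OF *(2)]
    have "\<forall>x\<in>set (alpha_part lam). odd x" "\<forall>x\<in>set (alpha_part mu). odd x"
      using lam(2) mu(2) set_alpha_part by blast+
    then have "alpha_part lam = alpha_part mu"
      using *(3) map_halves unfolding decomposition_def by (metis prod.inject)
    then have "mset lam = mset mu"
      using *(3) mset_alpha_beta[of lam] mset_alpha_beta[of mu] by (simp add: decomposition_def)
    then show "lam = mu"
      using lam(1) mu(1) by (intro sorted_wrt_ge_eqI) (simp_all flip: count_mset)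
  qed
  show "decomposition ` odd_parts n = decompositions n"
  proof (intro equalityI subsetI)
    fix z assume "z \<in> decompositions n"
    then obtain as \<beta> where z: "z = (as, \<beta>)" and as: "decreasing_pos as" and \<beta>: "distinct_odd \<beta>"
      and n: "(\<Sum>a\<leftarrow>as. 4 * a - 2) + sum_list \<beta> = n"
      by (auto simp: decompositions_def)
    define \<alpha> where "\<alpha> = map (\<lambda>a. 2 * a - 1) as"
    have as_eq: "as = map (\<lambda>x. (x + 1) div 2) \<alpha>"
      unfolding \<alpha>_def map_map using as by (intro map_idI[symmetric]) auto
    have odd: "\<forall>x\<in>set \<alpha>. odd x" using as by (auto simp: \<alpha>_def)
    have \<alpha>: "sorted_wrt (\<ge>) \<alpha>"
      unfolding \<alpha>_def sorted_wrt_map by (rule sorted_wrt_mono_rel[OF _ conjunct1[OF as]]) simp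
    \<comment> \<open>Multiplicities in \<open>\<beta>\<close> are at most 1, so halves and parities
      of the multiplicities in this merge give back \<open>\<alpha>\<close> and
      \<open>\<beta>\<close>.\<close>
    define lam where "lam = rev (sort (\<alpha> @ \<alpha> @ \<beta>))"
    have m: "mset lam = mset (\<alpha> @ \<alpha> @ \<beta>)" by (simp add: lam_def)
    have set: "set lam = set \<alpha> \<union> set \<beta>" by (simp add: lam_def)
    have count: "count_list lam i = 2 * count_list \<alpha> i + count_list \<beta> i" for i
      using arg_cong[OF m, of "\<lambda>m. count m i"] by (simp add: count_mset)
    have \<beta>1: "count_list \<beta> i \<le> 1" for i
      using count_list_distinct[OF sorted_wrt_greater_distinct] \<beta> by simp
    have "sum_list lam = n"
      using arg_cong[OF m, of sum_mset] n sum_list_halves[OF odd] as_eq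
      by (simp add: sum_mset_sum_list)
    moreover have "sorted_wrt (\<ge>) lam" by (simp add: lam_def sorted_wrt_rev)
    moreover have lodd: "\<forall>x\<in>set lam. odd x" using odd \<beta> set by auto
    moreover have "\<forall>x\<in>set lam. 0 < x" using lodd by (auto intro: odd_pos)
    ultimately have "lam \<in> odd_parts n" by (simp add: odd_parts_def is_partition_def)
    moreover have "alpha_part lam = \<alpha>"
    proof (rule sorted_wrt_ge_eqI[OF alpha_part_sorted \<alpha>])
      fix i show "count_list (alpha_part lam) i = count_list \<alpha> i"
        using \<beta>1[of i] by (simp add: count_list_alpha_part count)
    qed
    moreover have "beta_part lam = \<beta>"
    proof (rule sorted_wrt_ge_eqI)
      fix i show "count_list (beta_part lam) i = count_list \<beta> i"
        using \<beta>1[of i] by (simp add: count_list_beta_part count)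
    qed (use \<beta> beta_part_sorted sorted_wrt_greater_imp_ge in auto)
    ultimately show "z \<in> decomposition ` odd_parts n"
      unfolding z decomposition_def using as_eq by force
  qed (use decomposition_in in auto)
qed

section \<open>Assembling the extended map from its bijective stages\<close>

definition pairing :: "nat list \<times> nat list \<Rightarrow> (nat \<times> nat) list" where
  "pairing = (\<lambda>(as, \<beta>). insert_all (bressoud_pairs \<beta>) as)"

lemma bij_betw_pairing: "bij_betw pairing (decompositions n) {p. decr p \<and> pair_sum p = n}"
proof (rule bij_betw_imageI)
  show "inj_on pairing (decompositions n)"
  proof (rule inj_onI, clarify)
    fix as \<beta> bs \<gamma>
    assume *: "(as, \<beta>) \<in> decompositions n" "(bs, \<gamma>) \<in> decompositions n" "pairing (as, \<beta>) = pairing (bs, \<gamma>)"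
    then have d: "distinct_odd \<beta>" "distinct_odd \<gamma>" "decreasing_pos as" "decreasing_pos bs"
      by (auto simp: decompositions_def)
    have "bressoud_pairs \<beta> = bressoud_pairs \<gamma> \<and> as = bs"
      by (rule insert_all_inj)
        (use *(3) bressoud_pairs_props[OF d(1)] bressoud_pairs_props[OF d(2)] d in \<open>simp_all add: pairing_def\<close>)
    then show "as = bs \<and> \<beta> = \<gamma>" using bressoud_pairs_inj[OF d(1,2)] by blast
  qed
  show "pairing ` decompositions n = {p. decr p \<and> pair_sum p = n}"
  proof (intro equalityI subsetI)
    fix p assume "p \<in> pairing ` decompositions n"
    then obtain as \<beta> where p: "p = insert_all (bressoud_pairs \<beta>) as" "distinct_odd \<beta>" "decreasing_pos as"
      "(\<Sum>a\<leftarrow>as. 4 * a - 2) + sum_list \<beta> = n"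
      by (auto simp: decompositions_def pairing_def)
    then show "p \<in> {p. decr p \<and> pair_sum p = n}"
      using insert_all_removal_bound[of "bressoud_pairs \<beta>" as] insert_all_stats[of as "bressoud_pairs \<beta>"]
        bressoud_pairs_props[OF p(2)] by simp
  next
    fix p assume p: "p \<in> {p. decr p \<and> pair_sum p = n}"
    then obtain q as where q: "decr q" "reduced q" "decreasing_pos as" "insert_all q as = p"
      using insert_all_surj by blast
    obtain \<beta> where \<beta>: "distinct_odd \<beta>" "bressoud_pairs \<beta> = q" using bressoud_pairs_surj q(1,2) by blast
    have "(as, \<beta>) \<in> decompositions n"
      using q \<beta> p insert_all_stats[of as q] bressoud_pairs_props(3)[OF \<beta>(1)]
      by (auto simp: decompositions_def)
    moreover have "pairing (as, \<beta>) = p" using q \<beta> by (simp add: pairing_def)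
    ultimately show "p \<in> pairing ` decompositions n" by force
  qed
qed

text \<open>\<open>insert_pair_unpair\<close> applies at each stage because the order of the values
  keeps all intermediate lists decreasing.\<close>

lemma foldl_insert_pair:
  assumes "decr p" "reduced p"
  shows "decreasing_pos as \<Longrightarrow> foldl (\<lambda>g a. insert_pair a g) (unpair p) as = unpair (insert_all p as)"
proof (induction as rule: rev_induct)
  case (snoc a as)
  then have "decr (insert_all p as)" using insert_all_removal_bound[OF assms] by (simp add: sorted_wrt_append)
  then show ?case using snoc by (simp add: insert_pair_unpair sorted_wrt_append)
qed simp

lemma Phi_eq:
  assumes "lam \<in> odd_parts n"
  shows "Phi lam = unpair (pairing (decomposition lam))"
proof -
  have d: "decreasing_pos (map (\<lambda>x. (x + 1) div 2) (alpha_part lam))" "distinct_odd (beta_part lam)"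
    using decomposition_in[OF assms] by (auto simp: decomposition_def decompositions_def)
  have "Phi lam = foldl (\<lambda>g a. insert_pair a g) (unpair (bressoud_pairs (beta_part lam)))
      (map (\<lambda>x. (x + 1) div 2) (alpha_part lam))"
    by (simp add: Phi_def bressoud_eq foldl_map)
  also have "\<dots> = unpair (pairing (decomposition lam))"
    using foldl_insert_pair[OF bressoud_pairs_props(1,2)[OF d(2)] d(1)]
    by (simp add: pairing_def decomposition_def)
  finally show ?thesis .
qed

theorem mainTheorem2:
  fixes n :: nat
  assumes "0 < n"
  shows "bij_betw Phi (odd_parts n) (distinct_parts n)
    \<and> (\<forall>lam \<in> odd_parts n \<inter> distinct_parts n. Phi lam = bressoud lam)
    \<and> (\<forall>lam \<in> odd_parts n. alt_sum (Phi lam) = int (length lam)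
                             \<and> num_odd_parts (Phi lam) = n_odd_mult lam)"
proof (intro conjI ballI)
  have "bij_betw (unpair \<circ> (pairing \<circ> decomposition)) (odd_parts n) (distinct_parts n)"
    by (rule bij_betw_trans[OF bij_betw_trans[OF bij_betw_decomposition bij_betw_pairing] bij_betw_unpair])
  then show "bij_betw Phi (odd_parts n) (distinct_parts n)"
    by (subst bij_betw_cong[of _ _ "unpair \<circ> (pairing \<circ> decomposition)"]) (simp_all add: Phi_eq)
next
  fix lam assume "lam \<in> odd_parts n \<inter> distinct_parts n"
  then have lam: "sorted_wrt (>) lam" by (simp add: distinct_parts_eq)
  then have count: "count_list lam i \<le> 1" for i
    using count_list_distinct[OF sorted_wrt_greater_distinct] by simp
  \<comment> \<open>Multiplicities at most 1 have half 0, so nothing is inserted.\<close>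
  have "alpha_part lam = []"
  proof (rule sorted_wrt_ge_eqI[OF alpha_part_sorted])
    fix i show "count_list (alpha_part lam) i = count_list [] i"
      using count[of i] by (simp add: count_list_alpha_part)
  qed simp
  moreover have "beta_part lam = lam"
  proof (rule sorted_wrt_ge_eqI)
    fix i show "count_list (beta_part lam) i = count_list lam i"
      using count[of i] by (simp add: count_list_beta_part)
  qed (use lam beta_part_sorted sorted_wrt_greater_imp_ge in auto)
  ultimately show "Phi lam = bressoud lam" by (simp add: Phi_def)
next
  fix lam assume lam: "lam \<in> odd_parts n"
  let ?as = "map (\<lambda>x. (x + 1) div 2) (alpha_part lam)"
  have d: "decreasing_pos ?as" "distinct_odd (beta_part lam)"
    using decomposition_in[OF lam] by (auto simp: decomposition_def decompositions_def)
  let ?p = "insert_all (bressoud_pairs (beta_part lam)) ?as"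
  have Phi: "Phi lam = unpair ?p" using Phi_eq[OF lam] by (simp add: pairing_def decomposition_def)
  have "decr ?p" using insert_all_removal_bound[OF bressoud_pairs_props(1,2)[OF d(2)] d(1)] by blast
  \<comment> \<open>Each insertion adds 2, one for each of the two copies of a part of
    \<open>\<alpha>\<close>.\<close>
  moreover have "pair_alt ?p = int (length (beta_part lam)) + 2 * int (length (alpha_part lam))"
    using insert_all_stats[of ?as] d(1) bressoud_pairs_props(4)[OF d(2)] by simp
  moreover have "length lam = 2 * length (alpha_part lam) + length (beta_part lam)"
    using arg_cong[OF mset_alpha_beta[of lam], of size] by simp
  ultimately show "alt_sum (Phi lam) = int (length lam)"
    by (simp add: Phi alt_sum_unpair)
  have pos: "0 < i" if "odd (count_list lam i)" for i
  proof -
    have "i \<in> set (beta_part lam)" using that by (simp add: set_beta_part)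
    then have "odd i" using d(2) by blast
    then show ?thesis by (rule odd_pos)
  qed
  \<comment> \<open>Insertions do not change the number of odd entries, so only
    \<open>\<beta>\<close> contributes.\<close>
  have "num_odd_parts (Phi lam) = length (beta_part lam)"
    using insert_all_stats[of ?as] d(1) bressoud_pairs_props(5)[OF d(2)]
    by (simp add: Phi num_odd_parts_unpair)
  also have "\<dots> = card (set (beta_part lam))"
    using distinct_card[OF sorted_wrt_greater_distinct[OF beta_part_sorted]] by simp
  also have "set (beta_part lam) = {i. 0 < i \<and> odd (count_list lam i)}"
    unfolding set_beta_part using pos by blast
  finally show "num_odd_parts (Phi lam) = n_odd_mult lam" by (simp add: n_odd_mult_def)
qed

end
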